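(* For every constant integer $k\ge 1$, the randomized communication complexity in the message-passing model with $s$ players and edge duplication allowed of computing an additive $k$-spanner of an $n$-vertex input graph is $\Omega(s n^{4/3-o(1)})$ bits.
   Context: Message-passing model: there are $s$ players $P^1,\dots,P^s$ and a coordinator. All parties know the vertex set $V$, $|V|=n$; player $P^i$ holds an edge set $E_i$ on $V$, and the input graph is $G=(V,\bigcup_i E_i)$ (unweighted, undirected). Communication is only between the coordinator and individual players; the coordinator must output the answer. Communication cost is the total number of bits exchanged; randomized protocols must succeed with probability at least $2/3$ on every input. "With duplication" means the $E_i$ may overlap. An additive $\beta$-spanner of $G$ is a subgraph $H$ with $d_G(u,v)\le d_H(u,v)\le d_G(u,v)+\beta$ for all $u,v\in V$. Standing assumption: $s\ll n$ (e.g. $s=O(n^{\varepsilon})$ for small constant $\varepsilon$). *)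

theory Defs
  imports
    "HOL-Probability.Probability"
    "HOL-Library.Extended_Nat"
    "HOL-Library.Landau_Symbols"
begin

text \<open>
  The message-passing (coordinator) model: a coordinator without input and players
  \<open>0, \<dots>, s - 1\<close>, with one private two-way channel between the coordinator and each player.
  Protocols are described one bit at a time.  The coordinator sees all channels, and on the basis
  of everything exchanged so far it chooses a channel to use next, or announces the output.
  A player sees only its own input and its own channel.
\<close>

datatype party = Coordinator | Player

type_synonym view = "(party \<times> bool) list"
  \<comment> \<open>the bits exchanged on one channel, each with its sender\<close>

type_synonym transcript = "(nat \<times> party \<times> bool) list"
  \<comment> \<open>the bits exchanged on all channels, in order, each with its channel and its sender\<close>

definition view :: "nat \<Rightarrow> transcript \<Rightarrow> view" where
  "view i t = map snd (filter (\<lambda>e. fst e = i) t)"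

datatype 'out action = Send nat bool | Receive nat | Output 'out

datatype ('in, 'out) protocol =
  Protocol
    (turn: "nat \<Rightarrow> view \<Rightarrow> party")
    (coordinator: "transcript \<Rightarrow> 'out action")
    (player: "nat \<Rightarrow> 'in \<Rightarrow> view \<Rightarrow> bool")

text \<open>
  Only the \<open>s\<close> players are contacted, and the next sender on a channel is determined by the
  bits already exchanged on that channel.  Messages are therefore self-delimiting: the players
  know when it is their turn, and silence carries no information.
\<close>

definition well_formed :: "nat \<Rightarrow> ('in, 'out) protocol \<Rightarrow> bool" where
  "well_formed s P \<longleftrightarrow>
     (\<forall>t i b. coordinator P t = Send i b \<longrightarrow> i < s \<and> turn P i (view i t) = Coordinator) \<and>
     (\<forall>t i. coordinator P t = Receive i \<longrightarrow> i < s \<and> turn P i (view i t) = Player)"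

text \<open>
  The transcript after \<open>m\<close> steps on the inputs \<open>x 0, \<dots>, x (s - 1)\<close>.  Every step before the
  output exchanges exactly one bit.
\<close>

primrec transcript :: "('in, 'out) protocol \<Rightarrow> (nat \<Rightarrow> 'in) \<Rightarrow> nat \<Rightarrow> transcript" where
  "transcript P x 0 = []"
| "transcript P x (Suc m) =
     (let t = transcript P x m in
      case coordinator P t of
        Send i b \<Rightarrow> t @ [(i, Coordinator, b)]
      | Receive i \<Rightarrow> t @ [(i, Player, player P i (x i) (view i t))]
      | Output h \<Rightarrow> t)"

text \<open>On input \<open>x\<close> the output is \<open>h\<close>, announced after at most \<open>C\<close> bits of communication.\<close>

definition outputs :: "('in, 'out) protocol \<Rightarrow> (nat \<Rightarrow> 'in) \<Rightarrow> nat \<Rightarrow> 'out \<Rightarrow> bool" where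
  "outputs P x C h \<longleftrightarrow> coordinator P (transcript P x C) = Output h"

text \<open>
  A randomized protocol is a probability distribution on deterministic protocols (public coins;
  private coins are the special case of independent choices of the components).  Its cost is the
  number of bits exchanged in the worst case over inputs and coins.  The task is given by the
  set \<open>I\<close> of legal inputs and the relation \<open>R\<close> between inputs and correct outputs.
\<close>

definition randomized_protocol ::
  "nat \<Rightarrow> (nat \<Rightarrow> 'in) set \<Rightarrow> ((nat \<Rightarrow> 'in) \<Rightarrow> 'out \<Rightarrow> bool) \<Rightarrow> nat \<Rightarrow> ('in, 'out) protocol pmf \<Rightarrow> bool"
  where
  "randomized_protocol s I R C M \<longleftrightarrow>
     (\<forall>P\<in>set_pmf M. well_formed s P \<and> (\<forall>x\<in>I. \<exists>h. outputs P x C h)) \<and>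
     (\<forall>x\<in>I. measure_pmf.prob M {P. \<exists>h. outputs P x C h \<and> R x h} \<ge> 2 / 3)"

definition randomized_complexity ::
  "nat \<Rightarrow> (nat \<Rightarrow> 'in) set \<Rightarrow> ((nat \<Rightarrow> 'in) \<Rightarrow> 'out \<Rightarrow> bool) \<Rightarrow> nat" where
  "randomized_complexity s I R = (LEAST C. \<exists>M. randomized_protocol s I R C M)"

text \<open>
  Graphs on the vertex set \<open>{..<n}\<close> are given by their edge sets, an edge being a set of two
  vertices.  Distances are \<open>\<infinity>\<close> between different components.
\<close>

definition all_edges :: "nat \<Rightarrow> nat set set" where
  "all_edges n = {e. e \<subseteq> {..<n} \<and> card e = 2}"

definition graph_dist :: "nat set set \<Rightarrow> nat \<Rightarrow> nat \<Rightarrow> enat" where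
  "graph_dist E u v = Inf {enat m | m. (u, v) \<in> {(x, y). {x, y} \<in> E} ^^ m}"

definition additive_spanner :: "nat \<Rightarrow> nat \<Rightarrow> nat set set \<Rightarrow> nat set set \<Rightarrow> bool" where
  "additive_spanner n \<beta> E H \<longleftrightarrow>
     H \<subseteq> E \<and>
     (\<forall>u<n. \<forall>v<n. graph_dist E u v \<le> graph_dist H u v \<and>
                  graph_dist H u v \<le> graph_dist E u v + enat \<beta>)"

text \<open>With duplication: the edge sets of different players need not be disjoint.\<close>

definition edge_inputs :: "nat \<Rightarrow> nat \<Rightarrow> (nat \<Rightarrow> nat set set) set" where
  "edge_inputs n s = {E. \<forall>i<s. E i \<subseteq> all_edges n}"

definition spanner_complexity :: "nat \<Rightarrow> nat \<Rightarrow> nat \<Rightarrow> nat" where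
  "spanner_complexity n s \<beta> =
     randomized_complexity s (edge_inputs n s) (\<lambda>E H. additive_spanner n \<beta> (\<Union>i<s. E i) H)"

text \<open>
  The \<open>LEAST\<close> behind \<open>spanner_complexity\<close> ranges over a nonempty set: the players can send
  all of their edges to the coordinator.
\<close>

lemma finite_all_edges: "finite (all_edges n)"
  by (rule finite_subset[of _ "Pow {..<n}"]) (auto simp: all_edges_def)

lemma additive_spanner_refl: "additive_spanner n \<beta> E E"
  by (simp add: additive_spanner_def)

definition send_all :: "nat set list \<Rightarrow> nat \<Rightarrow> (nat set set, nat set set) protocol" where
  "send_all es s = Protocol
     (\<lambda>_ _. Player)
     (\<lambda>t. if length t < s * length es then Receive (length t div length es)
          else Output {es ! (p mod length es) | p. p < length t \<and> snd (snd (t ! p))})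
     (\<lambda>i X w. es ! length w \<in> X)"

lemma well_formed_send_all: "well_formed s (send_all es s)"
  by (auto simp: well_formed_def send_all_def less_mult_imp_div_less split: if_splits)

lemma transcript_send_all:
  assumes "m \<le> s * length es"
  shows "transcript (send_all es s) E m =
    map (\<lambda>p. (p div length es, Player, es ! (p mod length es) \<in> E (p div length es))) [0..<m]"
  using assms
proof (induction m)
  case (Suc m)
  let ?N = "length es"
  let ?f = "\<lambda>p. (p div ?N, Player, es ! (p mod ?N) \<in> E (p div ?N))"
  have N: "?N > 0" using Suc.prems by (cases "?N = 0") auto
  have "[0..<m] = [0..<m div ?N * ?N] @ [m div ?N * ?N..<m]"
    using upt_add_eq_append[of 0 "m div ?N * ?N" "m mod ?N"] by simp
  moreover have "filter (\<lambda>p. p div ?N = m div ?N) [0..<m div ?N * ?N] = []"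
    using less_mult_imp_div_less by (fastforce simp: filter_empty_conv)
  moreover have "filter (\<lambda>p. p div ?N = m div ?N) [m div ?N * ?N..<m] = [m div ?N * ?N..<m]"
  proof (rule filter_True, rule ballI)
    fix p assume "p \<in> set [m div ?N * ?N..<m]"
    then have "m div ?N * ?N \<le> p" "p \<le> m" by auto
    then have "m div ?N \<le> p div ?N" "p div ?N \<le> m div ?N"
      using N by (simp_all add: less_eq_div_iff_mult_less_eq[of ?N _ p] div_le_mono)
    then show "p div ?N = m div ?N" by simp
  qed
  ultimately have "length (filter (\<lambda>p. p div ?N = m div ?N) [0..<m]) = m mod ?N"
    by (metis append_Nil filter_append length_upt minus_div_mult_eq_mod)
  then have "length (view (m div ?N) (map ?f [0..<m])) = m mod ?N"
    by (simp add: view_def filter_map o_def)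
  moreover have "coordinator (send_all es s) (map ?f [0..<m]) = Receive (m div ?N)"
    using Suc.prems by (simp add: send_all_def)
  ultimately show ?case
    using Suc by (simp add: Let_def) (simp add: send_all_def)
qed simp

lemma outputs_send_all:
  assumes "E \<in> edge_inputs n s" "set es = all_edges n"
  shows "outputs (send_all es s) E (s * length es) (\<Union>i<s. E i)"
proof -
  let ?N = "length es"
  let ?t = "map (\<lambda>p. (p div ?N, Player, es ! (p mod ?N) \<in> E (p div ?N))) [0..<s * ?N]"
  have "{es ! (p mod ?N) | p. p < s * ?N \<and> es ! (p mod ?N) \<in> E (p div ?N)} = (\<Union>i<s. E i)"
  proof (intro subset_antisym subsetI)
    fix e assume "e \<in> (\<Union>i<s. E i)"
    then obtain i where i: "i < s" "e \<in> E i" by auto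
    then have "e \<in> set es" using assms by (auto simp: edge_inputs_def)
    then obtain j where j: "j < ?N" "e = es ! j" by (auto simp: in_set_conv_nth)
    have "i * ?N + j < s * ?N"
      using i(1) j(1) mult_le_mono1[of "Suc i" s ?N] by simp
    moreover have "(i * ?N + j) mod ?N = j" "(i * ?N + j) div ?N = i"
      using j(1) by (auto intro!: div_nat_eqI)
    ultimately show "e \<in> {es ! (p mod ?N) | p. p < s * ?N \<and> es ! (p mod ?N) \<in> E (p div ?N)}"
      using i j by (intro CollectI exI[of _ "i * ?N + j"]) auto
  qed (auto dest: less_mult_imp_div_less)
  moreover have "coordinator (send_all es s) ?t =
      Output {es ! (p mod ?N) | p. p < s * ?N \<and> es ! (p mod ?N) \<in> E (p div ?N)}"
    by (auto simp: send_all_def)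
  ultimately show ?thesis
    by (simp add: outputs_def transcript_send_all)
qed

lemma spanner_protocol_exists:
  "\<exists>C M. randomized_protocol s (edge_inputs n s)
           (\<lambda>E H. additive_spanner n \<beta> (\<Union>i<s. E i) H) C M"
proof -
  obtain es where es: "set es = all_edges n"
    using finite_list[OF finite_all_edges] by blast
  have "randomized_protocol s (edge_inputs n s)
          (\<lambda>E H. additive_spanner n \<beta> (\<Union>i<s. E i) H) (s * length es) (return_pmf (send_all es s))"
    unfolding randomized_protocol_def
    using outputs_send_all[OF _ es] additive_spanner_refl
    by (auto simp: well_formed_send_all measure_return_pmf indicator_def) blast+
  then show ?thesis by blast
qed

end

theory Submission
  imports Defs "HOL-Real_Asymp.Real_Asymp"
begin

text \<open>
  Graph side: in the obstacle product of Abboud and Bodwin every route between two prescribed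
  vertices uses \<open>2 * l - 1\<close> critical edges, each critical edge lies on a route, and leaving a route
  is expensive because labels are taken from an average-free set. Deleting any set of critical edges
  raises the distance between the ends of a route exactly by the number of its deleted edges, so an
  additive \<open>k\<close>-spanner keeps all but \<open>k\<close> of the critical edges present on each route, hence all but a
  small fraction of them. With \<open>O(q\<^sup>3)\<close> vertices there are \<open>q\<^sup>2 * card D\<^sup>2\<close> routes, where
  \<open>card D\<close> is nearly \<open>q\<close>.

  Communication side: the coordinator thus has to output most of the union of the players' sets of
  critical edges and nothing else. Given the view of one channel, the inputs of that player and of
  the rest range over a combinatorial rectangle, whose sides have small total bias because the entropy of the view
  is at most its expected length. If a player and the rest both have little bias at a
  coordinate, the output there cannot distinguish an empty column from a column containing only that
  player. Summing over coordinates and players gives \<open>\<Omega>(s)\<close> bits per critical edge.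
\<close>

section \<open>Bias, entropy and product means\<close>

text \<open>The obstacle on the communication side is that the entries of a column are dependent
  across the players, so the input of one player is not independent of the others. Each player
  \<open>i\<close> therefore gets its own decomposition of the same column law into modes. Given the
  modes, player \<open>i\<close> and the rest are functions of two independent uniform bit strings,
  and entropy can be charged to the bits of either side. The factor \<open>s\<close> arises because
  a view is charged only for the bits of its own channel, while the lengths of all views add up to
  at most the length of the transcript. The number 60 is a matter of margins. Treating empty and
  singleton columns alike costs an error of 9/20 per column, whereas the protocol may fail with
  probability 1/3 and the spanner may lose a share of 1/60 of the critical edges; this leaves 1/10.
  Hence routes have at least \<open>60 * k\<close> critical edges.\<close>

definition bias :: "'e \<Rightarrow> 'e set set \<Rightarrow> real" where
  "bias j S = (\<Sum>\<alpha>\<in>S. if j \<in> \<alpha> then 1 else - 1) / real (card S)"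

lemma abs_bias_le: "\<bar>bias j S\<bar> \<le> 1"
proof -
  have "\<bar>\<Sum>\<alpha>\<in>S. if j \<in> \<alpha> then 1 else - 1 :: real\<bar> \<le> (\<Sum>\<alpha>\<in>S. 1)"
    by (rule order_trans[OF sum_abs]) (intro sum_mono, auto)
  then show ?thesis by (cases "card S = 0") (auto simp: bias_def divide_simps)
qed

lemma bias_mult_card:
  "finite S \<Longrightarrow> bias j S * real (card S) = (\<Sum>\<alpha>\<in>S. if j \<in> \<alpha> then 1 else - 1)"
  by (cases "S = {}") (simp_all add: bias_def)

text \<open>Each factor is \<open>1 + \<theta> j\<close> or \<open>1 - \<theta> j\<close>, with sum
  2; expanding the product of these sums gives one term per subset.\<close>

lemma sum_Pow_prod_signs:
  fixes \<theta> :: "'e \<Rightarrow> real"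
  assumes "finite J"
  shows "(\<Sum>\<alpha>\<in>Pow J. \<Prod>j\<in>J. 1 + \<theta> j * (if j \<in> \<alpha> then 1 else - 1)) = 2 ^ card J"
proof -
  have "(\<Prod>j\<in>J. (1 + \<theta> j) + (1 - \<theta> j)) = (\<Sum>\<alpha>\<in>Pow J. (\<Prod>j\<in>\<alpha>. 1 + \<theta> j) * (\<Prod>j\<in>J - \<alpha>. 1 - \<theta> j))"
    by (rule prod_add[OF assms])
  also have "\<dots> = (\<Sum>\<alpha>\<in>Pow J. \<Prod>j\<in>J. 1 + \<theta> j * (if j \<in> \<alpha> then 1 else - 1))"
  proof (rule sum.cong[OF refl])
    fix \<alpha> assume "\<alpha> \<in> Pow J"
    then have "\<alpha> \<subseteq> J" by simp
    then have "(\<Prod>j\<in>J. 1 + \<theta> j * (if j \<in> \<alpha> then 1 else - 1))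
      = (\<Prod>j\<in>J - \<alpha>. 1 + \<theta> j * (if j \<in> \<alpha> then 1 else - 1)) *
        (\<Prod>j\<in>\<alpha>. 1 + \<theta> j * (if j \<in> \<alpha> then 1 else - 1))"
      by (rule prod.subset_diff[OF _ assms])
    then show "(\<Prod>j\<in>\<alpha>. 1 + \<theta> j) * (\<Prod>j\<in>J - \<alpha>. 1 - \<theta> j) =
        (\<Prod>j\<in>J. 1 + \<theta> j * (if j \<in> \<alpha> then 1 else - 1))"
      by simp
  qed
  finally show ?thesis by simp
qed

text \<open>Tilting the uniform measure on the cube by the factors \<open>1 + \<theta>\<^sub>j \<cdot> \<plusminus>1\<close> with
  \<open>\<theta>\<^sub>j = bias j S / 4\<close> keeps the total mass but multiplies the mass of \<open>S\<close>, by convexity,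
  by at least \<open>exp (\<Sum>\<^sub>j (bias j S)\<^sup>2 / 8)\<close>.\<close>

lemma sum_bias_squares_le:
  assumes J: "finite J" and S: "S \<subseteq> Pow J" "S \<noteq> {}"
  shows "(\<Sum>j\<in>J. (bias j S)\<^sup>2) \<le> 8 * ln (2 ^ card J / real (card S))"
proof -
  have fS: "finite S" using J S(1) by (meson finite_Pow_iff finite_subset)
  then have cS: "real (card S) > 0" using S(2) by (simp add: card_gt_0_iff)
  define \<sigma> :: "'a \<Rightarrow> 'a set \<Rightarrow> real" where "\<sigma> j \<alpha> = (if j \<in> \<alpha> then 1 else - 1)" for j \<alpha>
  define \<theta> where "\<theta> j = bias j S / 4" for j
  define y where "y \<alpha> = (\<Sum>j\<in>J. ln (1 + \<theta> j * \<sigma> j \<alpha>))" for \<alpha>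
  have \<theta>: "\<bar>\<theta> j * \<sigma> j \<alpha>\<bar> \<le> 1 / 4" for j \<alpha>
    using abs_bias_le[of j S] by (auto simp: \<theta>_def \<sigma>_def)
  have pos: "1 + \<theta> j * \<sigma> j \<alpha> > 0" for j \<alpha> using \<theta>[of j \<alpha>] by linarith
  have ln_ge: "ln (1 + \<theta> j * \<sigma> j \<alpha>) \<ge> \<theta> j * \<sigma> j \<alpha> - 2 * (\<theta> j)\<^sup>2" for j \<alpha>
  proof -
    have "\<bar>ln (1 + \<theta> j * \<sigma> j \<alpha>) - \<theta> j * \<sigma> j \<alpha>\<bar> \<le> 2 * (\<theta> j * \<sigma> j \<alpha>)\<^sup>2"
      by (rule abs_ln_one_plus_x_minus_x_bound) (use \<theta>[of j \<alpha>] in linarith)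
    moreover have "(\<theta> j * \<sigma> j \<alpha>)\<^sup>2 = (\<theta> j)\<^sup>2" by (auto simp: \<sigma>_def power2_eq_square)
    ultimately show ?thesis by linarith
  qed
  \<comment> \<open>For a bias \<open>b\<close> the choice \<open>\<theta> = b / 4\<close> maximizes
    \<open>\<theta> * b - 2 * \<theta>\<^sup>2\<close>, with value \<open>b\<^sup>2 / 8\<close>;
    this is the source of the 8.\<close>
  define a where "a = (\<Sum>j\<in>J. (bias j S)\<^sup>2) / 8"
  have "real (card S) * a = (\<Sum>j\<in>J. real (card S) * (\<theta> j * bias j S - 2 * (\<theta> j)\<^sup>2))"
    unfolding a_def \<theta>_def
    by (simp add: sum_distrib_left sum_divide_distrib power2_eq_square field_simps)
  also have "\<dots> = (\<Sum>j\<in>J. \<Sum>\<alpha>\<in>S. \<theta> j * \<sigma> j \<alpha> - 2 * (\<theta> j)\<^sup>2)"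
  proof (rule sum.cong[OF refl])
    fix j
    have "real (card S) * bias j S = (\<Sum>\<alpha>\<in>S. \<sigma> j \<alpha>)"
      using cS by (simp add: bias_def \<sigma>_def)
    then show "real (card S) * (\<theta> j * bias j S - 2 * (\<theta> j)\<^sup>2) = (\<Sum>\<alpha>\<in>S. \<theta> j * \<sigma> j \<alpha> - 2 * (\<theta> j)\<^sup>2)"
      by (simp add: sum_subtractf sum_distrib_left[symmetric] algebra_simps)
  qed
  also have "\<dots> \<le> (\<Sum>j\<in>J. \<Sum>\<alpha>\<in>S. ln (1 + \<theta> j * \<sigma> j \<alpha>))"
    by (intro sum_mono ln_ge)
  also have "\<dots> = (\<Sum>\<alpha>\<in>S. y \<alpha>)" unfolding y_def by (rule sum.swap)
  finally have a: "real (card S) * a \<le> (\<Sum>\<alpha>\<in>S. y \<alpha>)" .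
  \<comment> \<open>Jensen's inequality for \<open>exp\<close>, through its tangent at
    \<open>a\<close>, which is at most the mean of \<open>y\<close> over \<open>S\<close>.\<close>
  have "real (card S) * exp a \<le> exp a * (\<Sum>\<alpha>\<in>S. 1 + (y \<alpha> - a))"
    using a by (simp add: sum.distrib sum_subtractf algebra_simps)
  also have "\<dots> = (\<Sum>\<alpha>\<in>S. exp a * (1 + (y \<alpha> - a)))" by (simp add: sum_distrib_left)
  also have "\<dots> \<le> (\<Sum>\<alpha>\<in>S. exp (y \<alpha>))"
  proof (rule sum_mono)
    fix \<alpha>
    have "exp a * (1 + (y \<alpha> - a)) \<le> exp a * exp (y \<alpha> - a)"
      by (intro mult_left_mono exp_ge_add_one_self) auto
    then show "exp a * (1 + (y \<alpha> - a)) \<le> exp (y \<alpha>)" by (simp add: exp_diff)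
  qed
  also have "\<dots> \<le> (\<Sum>\<alpha>\<in>Pow J. exp (y \<alpha>))"
    using J S(1) by (intro sum_mono2) auto
  also have "\<dots> = (\<Sum>\<alpha>\<in>Pow J. \<Prod>j\<in>J. 1 + \<theta> j * \<sigma> j \<alpha>)"
    using pos J by (simp add: y_def exp_sum)
  also have "\<dots> = 2 ^ card J" unfolding \<sigma>_def by (rule sum_Pow_prod_signs[OF J])
  finally have "exp a \<le> 2 ^ card J / real (card S)" using cS by (simp add: field_simps)
  then have "a \<le> ln (2 ^ card J / real (card S))" using cS by (simp add: ln_ge_iff)
  then show ?thesis by (simp add: a_def)
qed

text \<open>Overwriting one coordinate by a fresh fair bit preserves the uniform measure on the
  cube.\<close>

lemma sum_Pow_resample:
  fixes g :: "'e set \<Rightarrow> real"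
  assumes "finite J" "j \<in> J"
  shows "(\<Sum>\<alpha>\<in>Pow J. g (insert j \<alpha>) + g (\<alpha> - {j})) = 2 * (\<Sum>\<alpha>\<in>Pow J. g \<alpha>)"
proof -
  define K where "K = J - {j}"
  have J: "J = insert j K" "j \<notin> K" "finite K" using assms by (auto simp: K_def)
  have split: "(\<Sum>\<alpha>\<in>Pow J. f \<alpha>) = (\<Sum>\<alpha>\<in>Pow K. f \<alpha> + f (insert j \<alpha>))" for f :: "'e set \<Rightarrow> real"
  proof -
    have "inj_on (insert j) (Pow K)" using J(2) by (auto simp: inj_on_def)
    moreover have "Pow K \<inter> insert j ` Pow K = {}" using J(2) by auto
    ultimately show ?thesis using J
      by (simp add: Pow_insert sum.union_disjoint sum.reindex o_def sum.distrib)
  qed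
  have "(\<Sum>\<alpha>\<in>Pow K. g (\<alpha> - {j})) = (\<Sum>\<alpha>\<in>Pow K. g \<alpha>)"
    using J(2) by (intro sum.cong refl arg_cong[of _ _ g]) auto
  then show ?thesis
    unfolding split by (simp add: sum.distrib sum_distrib_left[symmetric])
qed

lemma card_eq_sum_Pow: "finite J \<Longrightarrow> real (card {\<alpha>\<in>Pow J. Q \<alpha>}) = (\<Sum>\<alpha>\<in>Pow J. of_bool (Q \<alpha>))"
  by (simp add: of_bool_def sum.If_cases Int_def)

text \<open>\<open>Q1\<close> and \<open>Q0\<close> are \<open>Q\<close> with bit \<open>j\<close>
  forced to 1 and to 0: half the sum of their counts is the size, half the difference is size times
  bias. Multiplying by the size spares a case for empty sets.\<close>

lemma card_resample:
  assumes J: "finite J" "j \<in> J"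
    and Q1: "\<And>\<alpha>. \<alpha> \<subseteq> J \<Longrightarrow> Q (insert j \<alpha>) \<longleftrightarrow> Q1 \<alpha>"
    and Q0: "\<And>\<alpha>. \<alpha> \<subseteq> J \<Longrightarrow> Q (\<alpha> - {j}) \<longleftrightarrow> Q0 \<alpha>"
  shows "2 * real (card {\<alpha>\<in>Pow J. Q \<alpha>}) = real (card {\<alpha>\<in>Pow J. Q1 \<alpha>}) + real (card {\<alpha>\<in>Pow J. Q0 \<alpha>})"
    and "2 * (bias j {\<alpha>\<in>Pow J. Q \<alpha>} * real (card {\<alpha>\<in>Pow J. Q \<alpha>})) =
      real (card {\<alpha>\<in>Pow J. Q1 \<alpha>}) - real (card {\<alpha>\<in>Pow J. Q0 \<alpha>})"
proof -
  show "2 * real (card {\<alpha>\<in>Pow J. Q \<alpha>}) = real (card {\<alpha>\<in>Pow J. Q1 \<alpha>}) + real (card {\<alpha>\<in>Pow J. Q0 \<alpha>})"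
    unfolding card_eq_sum_Pow[OF J(1)] sum.distrib[symmetric] sum_Pow_resample[OF J, symmetric]
    by (intro sum.cong) (auto simp: Q1 Q0)
  let ?g = "\<lambda>\<alpha>. if Q \<alpha> then (if j \<in> \<alpha> then 1 else - 1) else 0 :: real"
  have fin: "finite {\<alpha>\<in>Pow J. Q \<alpha>}" using J(1) by simp
  have "bias j {\<alpha>\<in>Pow J. Q \<alpha>} * real (card {\<alpha>\<in>Pow J. Q \<alpha>}) =
      (\<Sum>\<alpha>\<in>{\<alpha>\<in>Pow J. Q \<alpha>}. if j \<in> \<alpha> then 1 else - 1)"
    by (rule bias_mult_card[OF fin])
  also have "\<dots> = (\<Sum>\<alpha>\<in>Pow J. ?g \<alpha>)"
    using J(1) by (intro sum.mono_neutral_cong_left) auto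
  finally have "2 * (bias j {\<alpha>\<in>Pow J. Q \<alpha>} * real (card {\<alpha>\<in>Pow J. Q \<alpha>})) =
      (\<Sum>\<alpha>\<in>Pow J. ?g (insert j \<alpha>) + ?g (\<alpha> - {j}))"
    using sum_Pow_resample[OF J, of ?g] by simp
  also have "\<dots> = (\<Sum>\<alpha>\<in>Pow J. of_bool (Q1 \<alpha>) - of_bool (Q0 \<alpha>))"
    by (intro sum.cong) (auto simp: Q1 Q0)
  also have "\<dots> = real (card {\<alpha>\<in>Pow J. Q1 \<alpha>}) - real (card {\<alpha>\<in>Pow J. Q0 \<alpha>})"
    unfolding card_eq_sum_Pow[OF J(1)] sum_subtractf ..
  finally show "2 * (bias j {\<alpha>\<in>Pow J. Q \<alpha>} * real (card {\<alpha>\<in>Pow J. Q \<alpha>})) =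
      real (card {\<alpha>\<in>Pow J. Q1 \<alpha>}) - real (card {\<alpha>\<in>Pow J. Q0 \<alpha>})" .
qed

text \<open>Gibbs' inequality against the sub-probability \<open>w \<mapsto> 1 / 8 ^ (length w + 1)\<close>.\<close>

lemma entropy_le_mean_length:
  fixes p :: "(party \<times> bool) list \<Rightarrow> real"
  assumes W: "W \<subseteq> {w. length w \<le> C}" and p: "\<And>w. w \<in> W \<Longrightarrow> p w \<ge> 0" "sum p W = 1"
  shows "(\<Sum>w\<in>W. p w * ln (1 / p w)) \<le> ln 8 * ((\<Sum>w\<in>W. p w * length w) + 1)"
proof -
  \<comment> \<open>Sender and bit make four symbols, hence \<open>4 ^ n\<close> words of length
    \<open>n\<close>; base 8 turns the total weight into a geometric series with sum at most
    1/4.\<close>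
  define q :: "(party \<times> bool) list \<Rightarrow> real" where "q w = 1 / 8 ^ (length w + 1)" for w
  have UNIV_party: "(UNIV :: party set) = {Coordinator, Player}"
    using party.exhaust by auto
  have fU: "finite (UNIV :: (party \<times> bool) set)"
    by (simp add: UNIV_Times_UNIV[symmetric] UNIV_party del: UNIV_Times_UNIV)
  have cU: "card (UNIV :: (party \<times> bool) set) = 4"
    by (simp add: UNIV_Times_UNIV[symmetric] UNIV_party card_cartesian_product del: UNIV_Times_UNIV)
  have fin: "finite {w :: (party \<times> bool) list. length w = n}" for n
    using finite_lists_length_eq[OF fU, of n] by simp
  have cl: "card {w :: (party \<times> bool) list. length w = n} = 4 ^ n" for n
    using card_lists_length_eq[OF fU, of n, unfolded cU] by simp
  have un: "{w :: (party \<times> bool) list. length w \<le> C} = (\<Union>n\<le>C. {w. length w = n})" by auto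
  have finC: "finite {w :: (party \<times> bool) list. length w \<le> C}" unfolding un using fin by auto
  have fW: "finite W" using W finC by (rule finite_subset)
  have "sum q W \<le> sum q {w. length w \<le> C}"
    using W finC by (intro sum_mono2) (auto simp: q_def)
  also have "\<dots> = (\<Sum>n\<le>C. \<Sum>w | length w = n. q w)"
    unfolding un using fin by (subst sum.UNION_disjoint) auto
  also have "\<dots> = (\<Sum>n\<le>C. (1 / 8) * (1 / 2) ^ n)"
  proof (rule sum.cong[OF refl])
    fix n
    have "(\<Sum>w | length w = n. q w) = 4 ^ n / 8 ^ (n + 1)" by (simp add: q_def cl)
    also have "\<dots> = (1 / 8) * (4 / 8) ^ n" by (simp only: power_divide) simp
    finally show "(\<Sum>w | length w = n. q w) = (1 / 8) * (1 / 2) ^ n" by simp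
  qed
  also have "\<dots> = (1 / 8) * (2 - (1 / 2) ^ C)"
    by (induction C) (simp_all add: field_simps)
  also have "\<dots> \<le> (1 / 8) * 2" by (intro mult_left_mono) auto
  finally have q: "sum q W \<le> 1" by simp
  have "p w * ln (1 / p w) \<le> p w * (ln 8 * (length w + 1)) + (q w - p w)" if "w \<in> W" for w
  proof (cases "p w = 0")
    case False
    then have pw: "p w > 0" using p(1)[OF that] by simp
    have "ln (q w / p w) \<le> q w / p w - 1"
      using pw by (intro ln_le_minus_one) (simp add: q_def)
    then have "p w * ln (q w / p w) \<le> q w - p w"
      using mult_left_mono[of _ _ "p w"] pw by (fastforce simp: field_simps)
    moreover have "ln (q w / p w) = ln (1 / p w) - ln 8 * (length w + 1)"
      using pw by (simp add: q_def ln_div ln_mult ln_realpow algebra_simps)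
    ultimately show ?thesis by (simp add: algebra_simps)
  qed (simp add: q_def)
  then have "(\<Sum>w\<in>W. p w * ln (1 / p w)) \<le> (\<Sum>w\<in>W. p w * (ln 8 * (length w + 1)) + (q w - p w))"
    by (rule sum_mono)
  also have "\<dots> = ln 8 * ((\<Sum>w\<in>W. p w * length w) + sum p W) + (sum q W - sum p W)"
    by (simp add: sum.distrib sum_subtractf sum_distrib_left sum_distrib_right algebra_simps)
  also have "\<dots> \<le> ln 8 * ((\<Sum>w\<in>W. p w * length w) + 1)" using q p(2) by simp
  finally show ?thesis .
qed

section \<open>Expectations under product laws\<close>

definition prod_mean :: "('c \<Rightarrow> real) \<Rightarrow> 'c set \<Rightarrow> 'e set \<Rightarrow> (('e \<Rightarrow> 'c) \<Rightarrow> real) \<Rightarrow> real" where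
  "prod_mean \<kappa> X J F = (\<Sum>x\<in>J \<rightarrow>\<^sub>E X. (\<Prod>j\<in>J. \<kappa> (x j)) * F x)"

lemma prod_mean_empty: "prod_mean \<kappa> X {} F = F (\<lambda>_. undefined)"
  by (simp add: prod_mean_def)

lemma prod_mean_insert:
  fixes F :: "('e \<Rightarrow> 'c) \<Rightarrow> real"
  assumes "finite J" "j \<notin> J"
  shows "prod_mean \<kappa> X (insert j J) F = (\<Sum>c\<in>X. \<kappa> c * prod_mean \<kappa> X J (\<lambda>x. F (x(j := c))))"
proof -
  have "prod_mean \<kappa> X (insert j J) F =
      (\<Sum>(c, x)\<in>X \<times> (J \<rightarrow>\<^sub>E X). (\<Prod>k\<in>insert j J. \<kappa> ((x(j := c)) k)) * F (x(j := c)))"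
    unfolding prod_mean_def PiE_insert_eq
    by (subst sum.reindex[OF inj_combinator[OF assms(2)]]) (simp add: case_prod_beta)
  also have "\<dots> = (\<Sum>(c, x)\<in>X \<times> (J \<rightarrow>\<^sub>E X). \<kappa> c * ((\<Prod>k\<in>J. \<kappa> (x k)) * F (x(j := c))))"
  proof (intro sum.cong refl)
    fix cx
    obtain c :: 'c and x :: "'e \<Rightarrow> 'c" where cx: "cx = (c, x)" by (cases cx)
    have "(\<Prod>k\<in>J. \<kappa> (if k = j then c else x k)) = (\<Prod>k\<in>J. \<kappa> (x k))"
      using assms(2) by (intro prod.cong) auto
    then show "(case cx of (c, x) \<Rightarrow> (\<Prod>k\<in>insert j J. \<kappa> ((x(j := c)) k)) * F (x(j := c))) =
        (case cx of (c, x) \<Rightarrow> \<kappa> c * ((\<Prod>k\<in>J. \<kappa> (x k)) * F (x(j := c))))"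
      using assms by (simp add: cx)
  qed
  also have "\<dots> = (\<Sum>c\<in>X. \<kappa> c * prod_mean \<kappa> X J (\<lambda>x. F (x(j := c))))"
    by (simp add: prod_mean_def sum.cartesian_product[symmetric] sum_distrib_left)
  finally show ?thesis .
qed

lemma prod_mean_mono:
  assumes "\<And>c. c \<in> X \<Longrightarrow> \<kappa> c \<ge> 0" "\<And>x. x \<in> J \<rightarrow>\<^sub>E X \<Longrightarrow> F x \<le> G x"
  shows "prod_mean \<kappa> X J F \<le> prod_mean \<kappa> X J G"
  unfolding prod_mean_def
  by (intro sum_mono mult_left_mono prod_nonneg assms) (auto simp: assms(1) PiE_mem)

lemma prod_mean_cong:
  assumes "\<And>x. x \<in> J \<rightarrow>\<^sub>E X \<Longrightarrow> F x = G x"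
  shows "prod_mean \<kappa> X J F = prod_mean \<kappa> X J G"
  unfolding prod_mean_def by (intro sum.cong) (auto simp: assms)

lemma prod_mean_add: "prod_mean \<kappa> X J (\<lambda>x. F x + G x) = prod_mean \<kappa> X J F + prod_mean \<kappa> X J G"
  by (simp add: prod_mean_def sum.distrib algebra_simps)

lemma prod_mean_diff: "prod_mean \<kappa> X J (\<lambda>x. F x - G x) = prod_mean \<kappa> X J F - prod_mean \<kappa> X J G"
  by (simp add: prod_mean_def sum_subtractf algebra_simps)

lemma prod_mean_scale: "prod_mean \<kappa> X J (\<lambda>x. a * F x) = a * prod_mean \<kappa> X J F"
  by (simp add: prod_mean_def sum_distrib_left algebra_simps)

lemma prod_mean_sum: "prod_mean \<kappa> X J (\<lambda>x. \<Sum>k\<in>K. F k x) = (\<Sum>k\<in>K. prod_mean \<kappa> X J (F k))"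
  unfolding prod_mean_def sum_distrib_left by (rule sum.swap)

lemma prod_mean_const:
  assumes "finite J" "finite X" "sum \<kappa> X = 1"
  shows "prod_mean \<kappa> X J (\<lambda>_. a) = a"
proof -
  have "(\<Sum>x\<in>J \<rightarrow>\<^sub>E X. \<Prod>j\<in>J. \<kappa> (x j)) = 1"
    using prod_sum_PiE[of J "\<lambda>_. X" "\<lambda>_. \<kappa>"] assms by simp
  then show ?thesis by (simp add: prod_mean_def sum_distrib_right[symmetric])
qed

text \<open>The inner mean ignores the overwritten coordinate, so drawing that coordinate afresh
  changes nothing.\<close>

lemma prod_mean_resample:
  assumes J: "finite J" "j \<in> J" and X: "sum \<kappa> X = 1"
  shows "prod_mean \<kappa> X J F = (\<Sum>c\<in>X. \<kappa> c * prod_mean \<kappa> X J (\<lambda>x. F (x(j := c))))"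
proof -
  define K where "K = J - {j}"
  have K: "J = insert j K" "j \<notin> K" "finite K" using J by (auto simp: K_def)
  have "prod_mean \<kappa> X J (\<lambda>x. F (x(j := c))) = prod_mean \<kappa> X K (\<lambda>x. F (x(j := c)))" for c
    unfolding K(1) by (subst prod_mean_insert[OF K(3,2)]) (simp add: sum_distrib_right[symmetric] X)
  then show ?thesis
    by (simp add: K(1) prod_mean_insert[OF K(3,2)])
qed

section \<open>Two-party information cost\<close>

text \<open>Seen from player \<open>i\<close>, a column (the set of players holding a given element) is generated by a
  latent mode and two independent fair bits, one for player \<open>i\<close> and one for the rest: \<open>Alice c\<close>
  re-randomizes the entry of player \<open>i\<close> in a dense column \<open>c\<close>, \<open>Bob c\<close> lets the rest be either
  dense or empty while player \<open>i\<close> has no entry, and \<open>Fixed c\<close> uses neither bit.\<close>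

datatype latent = Alice "nat set" | Bob "nat set" | Fixed "nat set"

fun own_bit :: "nat \<Rightarrow> latent \<Rightarrow> bool \<Rightarrow> bool" where
  "own_bit i (Alice c) a \<longleftrightarrow> a"
| "own_bit i (Bob c) a \<longleftrightarrow> False"
| "own_bit i (Fixed c) a \<longleftrightarrow> i \<in> c"

text \<open>In mode \<open>Bob\<close> the bit 1 stands for the empty rest: in
  \<open>coordinate_inequality\<close>, \<open>B0\<close> belongs to the dense and \<open>B1\<close>
  to the empty rest.\<close>

fun other_bits :: "nat \<Rightarrow> latent \<Rightarrow> bool \<Rightarrow> nat set" where
  "other_bits i (Alice c) b = c - {i}"
| "other_bits i (Bob c) b = (if b then {} else c - {i})"
| "other_bits i (Fixed c) b = c - {i}"

text \<open>\<open>A0, A1\<close> (\<open>B0, B1\<close>) are the probabilities that player \<open>i\<close> (the rest) is consistent with a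
  given view when its bit is 0 or 1. The left side is the contribution of the view to distinguishing
  the columns \<open>{}\<close> and \<open>{i}\<close>. Where \<open>B1 \<le> 2 * B0\<close> it is paid for by the bias \<open>u\<close> of player \<open>i\<close>,
  elsewhere by the bias \<open>v\<close> of the rest.\<close>

lemma coordinate_inequality:
  fixes A0 A1 B0 B1 u v z t :: real
  assumes nn: "0 \<le> A0" "0 \<le> A1" "0 \<le> B0" "0 \<le> z" "z \<le> B1" "t > 0"
    and u: "u * (A0 + A1) = A1 - A0" and v: "v * (B0 + B1) = B1 - B0"
  shows "z * (A0 - A1) \<le>
    B0 * (A0 + A1) * u\<^sup>2 / t + t * (B0 * (A0 + A1)) + 6 * (A0 * (B0 + B1) * v\<^sup>2)"
proof (cases "A0 \<le> A1")
  case True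
  then have "z * (A0 - A1) \<le> 0" using nn by (simp add: mult_nonneg_nonpos)
  moreover have "0 \<le> B0 * (A0 + A1) * u\<^sup>2 / t + t * (B0 * (A0 + A1)) + 6 * (A0 * (B0 + B1) * v\<^sup>2)"
    using nn by (intro add_nonneg_nonneg mult_nonneg_nonneg divide_nonneg_pos) auto
  ultimately show ?thesis by linarith
next
  case False
  have B1: "B1 \<ge> 0" using nn by simp
  show ?thesis
  proof (cases "B1 \<le> 2 * B0")
    case True
    \<comment> \<open>The inequality of arithmetic and geometric means trades a linear bias for a
      squared one, at the price of an additive \<open>t\<close> that is fixed only at the
      end.\<close>
    have "2 * (- u) \<le> u\<^sup>2 / t + t"
    proof -
      have "0 \<le> (u + t)\<^sup>2 / t" using nn by simp
      also have "\<dots> = u\<^sup>2 / t + 2 * u + t" using nn by (simp add: power2_sum field_simps power2_eq_square)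
      finally show ?thesis by simp
    qed
    then have "B0 * (A0 + A1) * (2 * (- u)) \<le> B0 * (A0 + A1) * (u\<^sup>2 / t + t)"
      using nn by (intro mult_left_mono) auto
    moreover have "B0 * (A0 + A1) * (2 * (- u)) = 2 * B0 * (A0 - A1)"
    proof -
      have "B0 * (A0 + A1) * (2 * (- u)) = - (2 * B0 * (u * (A0 + A1)))" by algebra
      also have "\<dots> = 2 * B0 * (A0 - A1)" by (simp only: u) (simp add: algebra_simps)
      finally show ?thesis .
    qed
    moreover have "z * (A0 - A1) \<le> 2 * B0 * (A0 - A1)"
      using nn True False by (intro mult_right_mono) auto
    moreover have "0 \<le> 6 * (A0 * (B0 + B1) * v\<^sup>2)" using nn B1 by simp
    ultimately show ?thesis by (simp add: algebra_simps)
  next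
    case False2: False
    have s: "B0 + B1 > 0" using False2 nn by linarith
    \<comment> \<open>Now \<open>v > 1 / 3\<close>, so the bias of the rest alone pays for the whole
      weight \<open>B1\<close>.\<close>
    have "B1 * (B0 + B1) \<le> 6 * (B1 - B0)\<^sup>2"
    proof -
      have "B1 / 2 \<le> B1 - B0" using False2 by simp
      then have "(B1 / 2)\<^sup>2 \<le> (B1 - B0)\<^sup>2" using B1 by (intro power_mono) auto
      moreover have "B1 * (B0 + B1) \<le> B1 * (3 / 2 * B1)"
        using False2 B1 by (intro mult_left_mono) auto
      ultimately show ?thesis by (simp add: power2_eq_square field_simps)
    qed
    also have "\<dots> = 6 * ((B0 + B1) * v\<^sup>2) * (B0 + B1)"
      unfolding v[symmetric] by (simp add: power2_eq_square algebra_simps)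
    finally have "B1 \<le> 6 * ((B0 + B1) * v\<^sup>2)" using s by (simp add: mult_le_cancel_right)
    then have "A0 * B1 \<le> A0 * (6 * ((B0 + B1) * v\<^sup>2))" using nn(1) by (rule mult_left_mono)
    moreover have "z * (A0 - A1) \<le> B1 * A0"
      using nn False B1 by (intro mult_mono) auto
    moreover have "0 \<le> B0 * (A0 + A1) * u\<^sup>2 / t + t * (B0 * (A0 + A1))"
      using nn by (intro add_nonneg_nonneg mult_nonneg_nonneg divide_nonneg_pos) auto
    ultimately show ?thesis by (simp add: algebra_simps)
  qed
qed

section \<open>Rectangles of views over two independent uniform strings\<close>

definition cube_mean :: "'e set \<Rightarrow> ('e set \<Rightarrow> 'e set \<Rightarrow> real) \<Rightarrow> real" where
  "cube_mean J f = (\<Sum>\<alpha>\<in>Pow J. \<Sum>\<beta>\<in>Pow J. f \<alpha> \<beta>) / 4 ^ card J"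

text \<open>A run as seen through one channel. The two sides are judged consistent with a view
  separately, so by \<open>ex1\<close> the views partition all pairs of inputs into combinatorial
  rectangles. \<open>Z\<close> has no access to the player's input: given the view, the output
  depends only on the other side.\<close>

locale two_party =
  fixes J :: "'e set" and i :: nat and W :: "view set" and C :: nat
    and Ac :: "view \<Rightarrow> 'e set \<Rightarrow> bool" and Bc :: "view \<Rightarrow> ('e \<Rightarrow> nat set) \<Rightarrow> bool"
    and Z :: "view \<Rightarrow> ('e \<Rightarrow> nat set) \<Rightarrow> 'e set"
  assumes finJ: "finite J" and finW: "finite W" and W: "W \<subseteq> {w. length w \<le> C}"
    and ex1: "\<exists>!w. w \<in> W \<and> Ac w y \<and> Bc w b"
begin

definition channel :: "'e set \<Rightarrow> ('e \<Rightarrow> nat set) \<Rightarrow> view" where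
  "channel y b = (THE w. w \<in> W \<and> Ac w y \<and> Bc w b)"

lemma channel: "w \<in> W \<and> Ac w y \<and> Bc w b \<longleftrightarrow> w = channel y b"
  unfolding channel_def using theI'[OF ex1] the1_equality[OF ex1] by blast

lemma sum_channel: "(\<Sum>w\<in>W. if Ac w y \<and> Bc w b then f w else 0) = f (channel y b)"
proof -
  have "(\<Sum>w\<in>W. if Ac w y \<and> Bc w b then f w else 0) = (\<Sum>w\<in>W. if w = channel y b then f w else 0)"
    using channel by (intro sum.cong) auto
  then show ?thesis using channel[of "channel y b" y b] finW by simp
qed

definition astr :: "('e \<Rightarrow> latent) \<Rightarrow> 'e set \<Rightarrow> 'e set" where
  "astr d \<alpha> = {j\<in>J. own_bit i (d j) (j \<in> \<alpha>)}"

definition bstr :: "('e \<Rightarrow> latent) \<Rightarrow> 'e set \<Rightarrow> 'e \<Rightarrow> nat set" where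
  "bstr d \<beta> = (\<lambda>j\<in>J. other_bits i (d j) (j \<in> \<beta>))"

definition aset :: "('e \<Rightarrow> latent) \<Rightarrow> view \<Rightarrow> 'e set set" where
  "aset d w = {\<alpha>\<in>Pow J. Ac w (astr d \<alpha>)}"

definition bset :: "('e \<Rightarrow> latent) \<Rightarrow> view \<Rightarrow> 'e set set" where
  "bset d w = {\<beta>\<in>Pow J. Bc w (bstr d \<beta>)}"

definition pa :: "('e \<Rightarrow> latent) \<Rightarrow> view \<Rightarrow> real" where
  "pa d w = real (card (aset d w)) / 2 ^ card J"

definition pb :: "('e \<Rightarrow> latent) \<Rightarrow> view \<Rightarrow> real" where
  "pb d w = real (card (bset d w)) / 2 ^ card J"

text \<open>\<open>pa d w * pb d w\<close> is the probability of the view \<open>w\<close> under the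
  modes \<open>d\<close>, so this is an expected squared bias. It stands in for the information that
  the view carries about the two bits at \<open>j\<close>.\<close>

definition info :: "('e \<Rightarrow> latent) \<Rightarrow> 'e \<Rightarrow> real" where
  "info d j = (\<Sum>w\<in>W. pa d w * pb d w * ((bias j (aset d w))\<^sup>2 + (bias j (bset d w))\<^sup>2))"

definition reported :: "('e \<Rightarrow> latent) \<Rightarrow> 'e \<Rightarrow> real" where
  "reported d j = cube_mean J (\<lambda>\<alpha> \<beta>.
     of_bool (j \<in> Z (channel (astr d \<alpha>) (bstr d \<beta>)) (bstr d \<beta>)))"

lemma fin_aset: "finite (aset d w)" and fin_bset: "finite (bset d w)"
  using finJ by (auto simp: aset_def bset_def)

text \<open>The modes \<open>d\<close> and \<open>d'\<close> of the two sides may differ: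
  \<open>reported_diff_le\<close> pairs player and rest from different columns through
  \<open>sum_pa_pb_1\<close>.\<close>

lemma sum_rectangles:
  "(\<Sum>w\<in>W. \<Sum>\<alpha>\<in>aset d w. \<Sum>\<beta>\<in>bset d' w. f w \<alpha> \<beta>) =
   (\<Sum>\<alpha>\<in>Pow J. \<Sum>\<beta>\<in>Pow J. f (channel (astr d \<alpha>) (bstr d' \<beta>)) \<alpha> \<beta> :: real)"
proof -
  have "(\<Sum>w\<in>W. \<Sum>\<alpha>\<in>aset d w. \<Sum>\<beta>\<in>bset d' w. f w \<alpha> \<beta>) =
    (\<Sum>w\<in>W. \<Sum>\<alpha>\<in>Pow J. \<Sum>\<beta>\<in>Pow J. if Ac w (astr d \<alpha>) \<and> Bc w (bstr d' \<beta>) then f w \<alpha> \<beta> else 0)"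
  proof (rule sum.cong[OF refl])
    fix w
    have "(\<Sum>\<alpha>\<in>aset d w. \<Sum>\<beta>\<in>bset d' w. f w \<alpha> \<beta>) =
      (\<Sum>\<alpha>\<in>Pow J. if Ac w (astr d \<alpha>) then \<Sum>\<beta>\<in>Pow J. if Bc w (bstr d' \<beta>) then f w \<alpha> \<beta> else 0 else 0)"
      unfolding aset_def bset_def using finJ by (simp only: sum.inter_filter finite_Pow_iff)
    also have "\<dots> = (\<Sum>\<alpha>\<in>Pow J. \<Sum>\<beta>\<in>Pow J.
        if Ac w (astr d \<alpha>) \<and> Bc w (bstr d' \<beta>) then f w \<alpha> \<beta> else 0)"
      by (intro sum.cong) (auto simp: if_distrib)
    finally show "(\<Sum>\<alpha>\<in>aset d w. \<Sum>\<beta>\<in>bset d' w. f w \<alpha> \<beta>) = \<dots>" .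
  qed
  also have "\<dots> = (\<Sum>\<alpha>\<in>Pow J. \<Sum>w\<in>W. \<Sum>\<beta>\<in>Pow J. if Ac w (astr d \<alpha>) \<and> Bc w (bstr d' \<beta>) then f w \<alpha> \<beta> else 0)"
    by (rule sum.swap)
  also have "\<dots> = (\<Sum>\<alpha>\<in>Pow J. \<Sum>\<beta>\<in>Pow J. \<Sum>w\<in>W. if Ac w (astr d \<alpha>) \<and> Bc w (bstr d' \<beta>) then f w \<alpha> \<beta> else 0)"
    by (intro sum.cong[OF refl] sum.swap)
  finally show ?thesis by (simp add: sum_channel)
qed

lemma pa_pb: "pa d w * pb d' w = (\<Sum>\<alpha>\<in>aset d w. \<Sum>\<beta>\<in>bset d' w. 1) / 4 ^ card J"
  by (simp add: pa_def pb_def power_mult_distrib[symmetric])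

lemma sum_pa_pb:
  "(\<Sum>w\<in>W. pa d w * pb d' w * f w) = cube_mean J (\<lambda>\<alpha> \<beta>. f (channel (astr d \<alpha>) (bstr d' \<beta>)))"
proof -
  have "(\<Sum>w\<in>W. pa d w * pb d' w * f w) = (\<Sum>w\<in>W. \<Sum>\<alpha>\<in>aset d w. \<Sum>\<beta>\<in>bset d' w. f w) / 4 ^ card J"
    unfolding pa_pb by (simp add: sum_divide_distrib mult.assoc)
  then show ?thesis by (simp only: sum_rectangles cube_mean_def)
qed

lemma sum_pa_pb_1: "(\<Sum>w\<in>W. pa d w * pb d' w) = 1"
  using sum_pa_pb[of d d' "\<lambda>_. 1"] finJ
  by (simp add: cube_mean_def card_Pow power_mult_distrib[symmetric])

lemma pa_nonneg: "pa d w \<ge> 0" and pb_nonneg: "pb d w \<ge> 0"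
  by (simp_all add: pa_def pb_def)

lemma info_nonneg: "info d j \<ge> 0"
  unfolding info_def by (intro sum_nonneg mult_nonneg_nonneg pa_nonneg pb_nonneg) auto

text \<open>For each view the squared biases of a side are bounded by the logarithmic deficiency of
  that side of the rectangle. The two deficiencies add up to the logarithm of the inverse
  probability of the view, whose mean is its entropy.\<close>

lemma sum_info_le:
  "(\<Sum>j\<in>J. info d j) \<le>
    8 * ln 8 * (cube_mean J (\<lambda>\<alpha> \<beta>. real (length (channel (astr d \<alpha>) (bstr d \<beta>)))) + 1)"
proof -
  have "(\<Sum>j\<in>J. info d j) = (\<Sum>w\<in>W. pa d w * pb d w *
      ((\<Sum>j\<in>J. (bias j (aset d w))\<^sup>2) + (\<Sum>j\<in>J. (bias j (bset d w))\<^sup>2)))"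
    unfolding info_def
    by (subst sum.swap) (simp add: sum_distrib_left[symmetric] sum.distrib[symmetric])
  also have "\<dots> \<le> (\<Sum>w\<in>W. 8 * (pa d w * pb d w * ln (1 / (pa d w * pb d w))))"
  proof (rule sum_mono)
    fix w
    show "pa d w * pb d w *
        ((\<Sum>j\<in>J. (bias j (aset d w))\<^sup>2) + (\<Sum>j\<in>J. (bias j (bset d w))\<^sup>2))
      \<le> 8 * (pa d w * pb d w * ln (1 / (pa d w * pb d w)))"
    proof (cases "aset d w = {} \<or> bset d w = {}")
      case True
      then have "pa d w = 0 \<or> pb d w = 0" by (auto simp: pa_def pb_def)
      then show ?thesis by auto
    next
      case False
      have pos: "pa d w > 0" "pb d w > 0"
        using False fin_aset fin_bset by (auto simp: pa_def pb_def card_gt_0_iff)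
      have "(\<Sum>j\<in>J. (bias j (aset d w))\<^sup>2) \<le> 8 * ln (1 / pa d w)"
        using sum_bias_squares_le[OF finJ, of "aset d w"] False by (auto simp: aset_def pa_def)
      moreover have "(\<Sum>j\<in>J. (bias j (bset d w))\<^sup>2) \<le> 8 * ln (1 / pb d w)"
        using sum_bias_squares_le[OF finJ, of "bset d w"] False by (auto simp: bset_def pb_def)
      ultimately have "(\<Sum>j\<in>J. (bias j (aset d w))\<^sup>2) + (\<Sum>j\<in>J. (bias j (bset d w))\<^sup>2)
          \<le> 8 * ln (1 / (pa d w * pb d w))"
        using pos by (simp add: ln_div ln_mult)
      then have "pa d w * pb d w * ((\<Sum>j\<in>J. (bias j (aset d w))\<^sup>2) + (\<Sum>j\<in>J. (bias j (bset d w))\<^sup>2))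
          \<le> pa d w * pb d w * (8 * ln (1 / (pa d w * pb d w)))"
        using pos by (intro mult_left_mono) auto
      then show ?thesis by (simp add: algebra_simps)
    qed
  qed
  also have "\<dots> = 8 * (\<Sum>w\<in>W. pa d w * pb d w * ln (1 / (pa d w * pb d w)))"
    by (simp add: sum_distrib_left)
  also have "\<dots> \<le> 8 * (ln 8 * ((\<Sum>w\<in>W. pa d w * pb d w * real (length w)) + 1))"
    using pa_nonneg pb_nonneg sum_pa_pb_1
    by (intro mult_left_mono entropy_le_mean_length[OF W]) auto
  finally show ?thesis by (simp add: sum_pa_pb)
qed

lemma astr_upd:
  assumes "j \<in> J"
  shows "astr (d(j := l)) \<alpha> = {k\<in>J. k \<noteq> j \<and> own_bit i (d k) (k \<in> \<alpha>)} \<union> {k. k = j \<and> own_bit i l (j \<in> \<alpha>)}"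
  using assms by (auto simp: astr_def)

lemma bstr_upd:
  assumes "j \<in> J"
  shows "bstr (d(j := l)) \<beta> = (bstr d \<beta>)(j := other_bits i l (j \<in> \<beta>))"
  using assms by (auto simp: bstr_def fun_eq_iff)

lemma bstr_toggle:
  assumes "j \<in> J"
  shows "(bstr d (insert j \<beta>))(j := c) = (bstr d \<beta>)(j := c)"
    and "(bstr d (\<beta> - {j}))(j := c) = (bstr d \<beta>)(j := c)"
  using assms by (auto simp: bstr_def fun_eq_iff)

lemma pb_Alice: "j \<in> J \<Longrightarrow> pb (d(j := Alice c)) w = pb (d(j := Fixed c)) w"
  and pa_Bob: "j \<in> J \<Longrightarrow> pa (d(j := Bob c)) w = pa (d(j := Fixed {})) w"
  and bstr_Fixed_own: "j \<in> J \<Longrightarrow> bstr (d(j := Fixed {i})) \<beta> = bstr (d(j := Fixed {})) \<beta>"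
  by (simp_all add: pa_def pb_def aset_def bset_def astr_upd bstr_upd)

lemma pa_Alice:
  assumes j: "j \<in> J"
  shows "2 * pa (d(j := Alice c)) w = pa (d(j := Fixed {})) w + pa (d(j := Fixed {i})) w" (is ?A)
    and "2 * (bias j (aset (d(j := Alice c)) w) * pa (d(j := Alice c)) w) =
      pa (d(j := Fixed {i})) w - pa (d(j := Fixed {})) w" (is ?B)
proof -
  note r = card_resample[OF finJ j, of "\<lambda>\<alpha>. Ac w (astr (d(j := Alice c)) \<alpha>)"
      "\<lambda>\<alpha>. Ac w (astr (d(j := Fixed {i})) \<alpha>)" "\<lambda>\<alpha>. Ac w (astr (d(j := Fixed {})) \<alpha>)"]
  have e: "astr (d(j := Alice c)) (insert j \<alpha>) = astr (d(j := Fixed {i})) \<alpha>"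
    "astr (d(j := Alice c)) (\<alpha> - {j}) = astr (d(j := Fixed {})) \<alpha>" for \<alpha>
    using j by (auto simp: astr_upd)
  show ?A ?B
    using r unfolding e aset_def pa_def by (simp_all add: field_simps)
qed

lemma pb_Bob:
  assumes j: "j \<in> J"
  shows "2 * pb (d(j := Bob c)) w = pb (d(j := Fixed c)) w + pb (d(j := Fixed {})) w" (is ?A)
    and "2 * (bias j (bset (d(j := Bob c)) w) * pb (d(j := Bob c)) w) =
      pb (d(j := Fixed {})) w - pb (d(j := Fixed c)) w" (is ?B)
proof -
  note r = card_resample[OF finJ j, of "\<lambda>\<beta>. Bc w (bstr (d(j := Bob c)) \<beta>)"
      "\<lambda>\<beta>. Bc w (bstr (d(j := Fixed {})) \<beta>)" "\<lambda>\<beta>. Bc w (bstr (d(j := Fixed c)) \<beta>)"]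
  have e: "bstr (d(j := Bob c)) (insert j \<beta>) = bstr (d(j := Fixed {})) \<beta>"
    "bstr (d(j := Bob c)) (\<beta> - {j}) = bstr (d(j := Fixed c)) \<beta>" for \<beta>
    using j by (simp_all add: bstr_upd bstr_toggle)
  show ?A ?B
    using r unfolding e bset_def pb_def by (simp_all add: field_simps)
qed

text \<open>Columns \<open>{}\<close> and \<open>{i}\<close> look the same to the rest, so only
  player \<open>i\<close>'s side can separate them. The bias of player \<open>i\<close> is measured
  while the rest is dense (\<open>Alice\<close>), but the separation happens while the rest is
  empty; \<open>Bob\<close> measures how well a view tells these two situations apart.\<close>

lemma reported_diff_le:
  assumes j: "j \<in> J" and t: "t > 0"
  shows "reported (d(j := Fixed {i})) j - reported (d(j := Fixed {})) j
    \<le> 2 / t * info (d(j := Alice c)) j + 12 * info (d(j := Bob c)) j + 2 * t"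
proof -
  let ?d1 = "d(j := Fixed {i})" and ?d0 = "d(j := Fixed {})" and ?dc = "d(j := Fixed c)"
  let ?dA = "d(j := Alice c)" and ?dB = "d(j := Bob c)"
  define Bz where "Bz w = real (card {\<beta>\<in>bset ?d0 w. j \<in> Z w (bstr ?d0 \<beta>)}) / 2 ^ card J" for w
  define u where "u w = bias j (aset ?dA w)" for w
  define v where "v w = bias j (bset ?dB w)" for w
  have rep: "reported d' j = (\<Sum>w\<in>W. pa d' w * Bz w)" if "bstr d' = bstr ?d0" for d'
  proof -
    have bs: "bset d' w = bset ?d0 w" for w using that by (simp add: bset_def)
    have "reported d' j = (\<Sum>w\<in>W. \<Sum>\<alpha>\<in>aset d' w. \<Sum>\<beta>\<in>bset d' w. of_bool (j \<in> Z w (bstr d' \<beta>))) / 4 ^ card J"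
      by (simp only: reported_def cube_mean_def sum_rectangles)
    also have "\<dots> = (\<Sum>w\<in>W. pa d' w * Bz w)"
    proof (subst sum_divide_distrib, rule sum.cong[OF refl])
      fix w
      have "(\<Sum>\<beta>\<in>bset d' w. of_bool (j \<in> Z w (bstr d' \<beta>))) = real (card {\<beta>\<in>bset ?d0 w. j \<in> Z w (bstr ?d0 \<beta>)})"
        unfolding that bs using fin_bset by (simp add: of_bool_def sum.If_cases Int_def)
      then show "(\<Sum>\<alpha>\<in>aset d' w. \<Sum>\<beta>\<in>bset d' w. of_bool (j \<in> Z w (bstr d' \<beta>))) / 4 ^ card J = pa d' w * Bz w"
        by (simp add: pa_def Bz_def power_mult_distrib[symmetric])
    qed
    finally show ?thesis .
  qed
  have Bz: "0 \<le> Bz w" "Bz w \<le> pb ?d0 w" for w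
    using fin_bset by (auto simp: Bz_def pb_def intro!: divide_right_mono card_mono)
  have u: "u w * (pa ?d0 w + pa ?d1 w) = pa ?d1 w - pa ?d0 w" for w
    unfolding u_def pa_Alice[OF j, of d c, symmetric] by simp
  have v: "v w * (pb ?dc w + pb ?d0 w) = pb ?d0 w - pb ?dc w" for w
    unfolding v_def pb_Bob[OF j, of d c, symmetric] by simp
  have "reported ?d1 j - reported ?d0 j = (\<Sum>w\<in>W. (pa ?d1 w - pa ?d0 w) * Bz w)"
    using rep[of ?d1] rep[of ?d0] bstr_Fixed_own[OF j]
    by (simp add: fun_eq_iff sum_subtractf left_diff_distrib)
  \<comment> \<open>Both columns have total probability 1, so reporting more under
    \<open>?d1\<close> means staying silent more under \<open>?d0\<close>. The positive part of the
    loss then carries the factor \<open>pa ?d0\<close>, the one that occurs in mode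
    \<open>Bob\<close>, where player \<open>i\<close> has no entry.\<close>
  also have "\<dots> = (\<Sum>w\<in>W. (pb ?d0 w - Bz w) * (pa ?d0 w - pa ?d1 w)) +
      ((\<Sum>w\<in>W. pa ?d1 w * pb ?d0 w) - (\<Sum>w\<in>W. pa ?d0 w * pb ?d0 w))"
    by (simp add: sum_subtractf[symmetric] sum.distrib[symmetric] algebra_simps)
  also have "\<dots> = (\<Sum>w\<in>W. (pb ?d0 w - Bz w) * (pa ?d0 w - pa ?d1 w))"
    by (simp add: sum_pa_pb_1)
  also have "\<dots> \<le> (\<Sum>w\<in>W. pb ?dc w * (pa ?d0 w + pa ?d1 w) * (u w)\<^sup>2 / t +
      t * (pb ?dc w * (pa ?d0 w + pa ?d1 w)) + 6 * (pa ?d0 w * (pb ?dc w + pb ?d0 w) * (v w)\<^sup>2))"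
    using Bz t u v by (intro sum_mono coordinate_inequality pa_nonneg pb_nonneg) auto
  also have "\<dots> = (\<Sum>w\<in>W. 2 / t * (pa ?dA w * pb ?dA w * (u w)\<^sup>2) +
      t * (pa ?d0 w * pb ?dc w + pa ?d1 w * pb ?dc w) + 12 * (pa ?dB w * pb ?dB w * (v w)\<^sup>2))"
  proof (rule sum.cong[OF refl])
    fix w
    have "pb ?dc w * (pa ?d0 w + pa ?d1 w) * (u w)\<^sup>2 / t = 2 / t * (pa ?dA w * pb ?dA w * (u w)\<^sup>2)"
      unfolding pa_Alice(1)[OF j, of d c, symmetric] pb_Alice[OF j] by simp
    moreover have "6 * (pa ?d0 w * (pb ?dc w + pb ?d0 w) * (v w)\<^sup>2) =
        12 * (pa ?dB w * pb ?dB w * (v w)\<^sup>2)"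
      unfolding pb_Bob(1)[OF j, of d c, symmetric] pa_Bob[OF j] by simp
    moreover have "t * (pb ?dc w * (pa ?d0 w + pa ?d1 w)) = t * (pa ?d0 w * pb ?dc w + pa ?d1 w * pb ?dc w)"
      by (simp add: algebra_simps)
    ultimately show "pb ?dc w * (pa ?d0 w + pa ?d1 w) * (u w)\<^sup>2 / t +
      t * (pb ?dc w * (pa ?d0 w + pa ?d1 w)) + 6 * (pa ?d0 w * (pb ?dc w + pb ?d0 w) * (v w)\<^sup>2) =
      2 / t * (pa ?dA w * pb ?dA w * (u w)\<^sup>2) +
      t * (pa ?d0 w * pb ?dc w + pa ?d1 w * pb ?dc w) + 12 * (pa ?dB w * pb ?dB w * (v w)\<^sup>2)"
      by (simp only:)
  qed
  also have "\<dots> = 2 / t * (\<Sum>w\<in>W. pa ?dA w * pb ?dA w * (u w)\<^sup>2) + t * 2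
      + 12 * (\<Sum>w\<in>W. pa ?dB w * pb ?dB w * (v w)\<^sup>2)"
    by (simp add: sum.distrib sum_distrib_left[symmetric] sum_divide_distrib[symmetric] sum_pa_pb_1)
  also have "\<dots> \<le> 2 / t * info ?dA j + t * 2 + 12 * info ?dB j"
    unfolding info_def u_def v_def using t
    by (intro add_mono mult_left_mono sum_mono order_refl pa_nonneg pb_nonneg mult_nonneg_nonneg) auto
  finally show ?thesis by (simp add: algebra_simps)
qed

text \<open>A coordinate takes mode \<open>Alice c\<close> or \<open>Bob c\<close> with weight
  \<open>k0\<close> each. By \<open>prod_mean_resample\<close> the terms with an overwritten mode
  are therefore part of the mean of \<open>info\<close> under the law of the modes itself, which
  \<open>sum_info_le\<close> bounds for all coordinates at once.\<close>

lemma sum_reported_diff_le: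
  fixes L :: "latent set" and \<kappa> :: "latent \<Rightarrow> real"
  assumes L: "finite L" "sum \<kappa> L = 1" "\<And>l. l \<in> L \<Longrightarrow> \<kappa> l \<ge> 0"
    and Cs: "finite Cs" "Alice ` Cs \<subseteq> L" "Bob ` Cs \<subseteq> L"
    and k0: "\<And>c. c \<in> Cs \<Longrightarrow> \<kappa> (Alice c) = k0" "\<And>c. c \<in> Cs \<Longrightarrow> \<kappa> (Bob c) = k0" "k0 \<ge> 0"
    and t: "0 < t" "t \<le> 1 / 6"
  shows "k0 * card Cs * (\<Sum>j\<in>J. prod_mean \<kappa> L J (\<lambda>d.
      reported (d(j := Fixed {i})) j - reported (d(j := Fixed {})) j))
    \<le> 16 * ln 8 / t * (prod_mean \<kappa> L J (\<lambda>d.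
        cube_mean J (\<lambda>\<alpha> \<beta>. real (length (channel (astr d \<alpha>) (bstr d \<beta>))))) + 1)
      + 2 * t * (k0 * card Cs) * card J"
proof -
  let ?E = "prod_mean \<kappa> L J"
  let ?\<delta> = "\<lambda>j d. reported (d(j := Fixed {i})) j - reported (d(j := Fixed {})) j"
  have one: "k0 * card Cs * ?E (?\<delta> j) \<le> 2 / t * ?E (\<lambda>d. info d j) + 2 * t * (k0 * card Cs)"
    if j: "j \<in> J" for j
  proof -
    have "k0 * card Cs * ?E (?\<delta> j) = (\<Sum>c\<in>Cs. k0 * ?E (?\<delta> j))" by simp
    also have "\<dots> \<le> (\<Sum>c\<in>Cs. k0 * (2 / t * ?E (\<lambda>d. info (d(j := Alice c)) j)
        + 2 / t * ?E (\<lambda>d. info (d(j := Bob c)) j) + 2 * t))"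
    proof (intro sum_mono mult_left_mono k0(3))
      fix c
      \<comment> \<open>This is what \<open>t \<le> 1 / 6\<close> is for: both kinds of
        \<open>info\<close> get the same coefficient.\<close>
      have "12 \<le> 2 / t" using t by (simp add: field_simps)
      then have "12 * info (d(j := Bob c)) j \<le> 2 / t * info (d(j := Bob c)) j" for d
        using info_nonneg by (rule mult_right_mono)
      then have "?\<delta> j d \<le> 2 / t * info (d(j := Alice c)) j + 2 / t * info (d(j := Bob c)) j + 2 * t" for d
        using reported_diff_le[OF j t(1), of d c] by (smt (verit))
      then have "?E (?\<delta> j) \<le> ?E (\<lambda>d. 2 / t * info (d(j := Alice c)) j
          + 2 / t * info (d(j := Bob c)) j + 2 * t)"
        by (intro prod_mean_mono L(3))
      then show "?E (?\<delta> j) \<le> 2 / t * ?E (\<lambda>d. info (d(j := Alice c)) j)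
        + 2 / t * ?E (\<lambda>d. info (d(j := Bob c)) j) + 2 * t"
        by (simp only: prod_mean_add prod_mean_scale prod_mean_const[OF finJ L(1,2)])
    qed
    also have "\<dots> = 2 / t * ((\<Sum>c\<in>Cs. k0 * ?E (\<lambda>d. info (d(j := Alice c)) j))
        + (\<Sum>c\<in>Cs. k0 * ?E (\<lambda>d. info (d(j := Bob c)) j))) + 2 * t * (k0 * card Cs)"
      by (simp add: sum.distrib sum_distrib_left algebra_simps)
    also have "\<dots> \<le> 2 / t * ?E (\<lambda>d. info d j) + 2 * t * (k0 * card Cs)"
    proof -
      let ?f = "\<lambda>l. \<kappa> l * ?E (\<lambda>d. info (d(j := l)) j)"
      have Enn: "?E (\<lambda>d. info (d(j := l)) j) \<ge> 0" for l
        using prod_mean_mono[of L \<kappa> J "\<lambda>_. 0" "\<lambda>d. info (d(j := l)) j"] L info_nonneg finJ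
        by (simp add: prod_mean_const)
      have "(\<Sum>c\<in>Cs. k0 * ?E (\<lambda>d. info (d(j := Alice c)) j)) = sum ?f (Alice ` Cs)"
        by (subst sum.reindex) (auto simp: inj_on_def k0)
      moreover have "(\<Sum>c\<in>Cs. k0 * ?E (\<lambda>d. info (d(j := Bob c)) j)) = sum ?f (Bob ` Cs)"
        by (subst sum.reindex) (auto simp: inj_on_def k0)
      moreover have "sum ?f (Alice ` Cs) + sum ?f (Bob ` Cs) = sum ?f (Alice ` Cs \<union> Bob ` Cs)"
        using Cs(1) by (intro sum.union_disjoint[symmetric]) auto
      moreover have "\<dots> \<le> sum ?f L"
        using Cs L Enn by (intro sum_mono2) auto
      moreover have "sum ?f L = ?E (\<lambda>d. info d j)"
        using prod_mean_resample[OF finJ j L(2), of "\<lambda>d. info d j"] by simp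
      ultimately show ?thesis using t by (intro add_right_mono mult_left_mono) auto
    qed
    finally show ?thesis .
  qed
  have "k0 * card Cs * (\<Sum>j\<in>J. ?E (?\<delta> j)) = (\<Sum>j\<in>J. k0 * card Cs * ?E (?\<delta> j))"
    by (simp add: sum_distrib_left)
  also have "\<dots> \<le> (\<Sum>j\<in>J. 2 / t * ?E (\<lambda>d. info d j) + 2 * t * (k0 * card Cs))"
    by (intro sum_mono one)
  also have "\<dots> = 2 / t * ?E (\<lambda>d. \<Sum>j\<in>J. info d j) + 2 * t * (k0 * card Cs) * card J"
    by (simp add: sum.distrib sum_distrib_left[symmetric] sum_divide_distrib[symmetric] prod_mean_sum)
  also have "\<dots> \<le> 2 / t * ?E (\<lambda>d. 8 * ln 8 *
      (cube_mean J (\<lambda>\<alpha> \<beta>. real (length (channel (astr d \<alpha>) (bstr d \<beta>)))) + 1)) + 2 * t * (k0 * card Cs) * card J"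
    using t L(3) by (intro add_right_mono mult_left_mono prod_mean_mono sum_info_le) auto
  also have "\<dots> = 16 * ln 8 / t * (?E (\<lambda>d.
        cube_mean J (\<lambda>\<alpha> \<beta>. real (length (channel (astr d \<alpha>) (bstr d \<beta>))))) + 1)
      + 2 * t * (k0 * card Cs) * card J"
    by (simp only: prod_mean_add prod_mean_scale prod_mean_const[OF finJ L(1,2)]) simp
  finally show ?thesis .
qed

end

section \<open>Channels and column laws\<close>

definition consistent :: "('in, 'out) protocol \<Rightarrow> nat \<Rightarrow> 'in \<Rightarrow> view \<Rightarrow> bool" where
  "consistent P i a w \<longleftrightarrow>
     (\<forall>k<length w. fst (w ! k) = Player \<longrightarrow> snd (w ! k) = player P i a (take k w))"

lemma consistent_Nil: "consistent P i a []"
  by (simp add: consistent_def)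

lemma consistent_snoc:
  "consistent P i a (w @ [(p, b)]) \<longleftrightarrow>
     consistent P i a w \<and> (p = Player \<longrightarrow> b = player P i a w)"
  by (auto simp: consistent_def nth_append less_Suc_eq)

lemma view_Nil [simp]: "view i [] = []"
  by (simp add: view_def)

lemma view_snoc [simp]: "view i (t @ [(k, e)]) = (if k = i then view i t @ [e] else view i t)"
  by (simp add: view_def)

lemma transcript_Suc:
  "transcript P x (Suc m) = transcript P x m @
     (case coordinator P (transcript P x m) of
        Send i b \<Rightarrow> [(i, Coordinator, b)]
      | Receive i \<Rightarrow> [(i, Player, player P i (x i) (view i (transcript P x m)))]
      | Output h \<Rightarrow> [])"
  by (simp add: Let_def split: action.split)

lemma consistent_view: "consistent P i (x i) (view i (transcript P x m))"
  by (induction m) (auto simp: consistent_Nil Let_def consistent_snoc split: action.split)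

lemma consistent_transcript_mono:
  assumes "consistent P i a (view i (transcript P x C))" "m \<le> C"
  shows "consistent P i a (view i (transcript P x m))"
  using assms(2,1)
proof (induction C rule: dec_induct)
  case (step n)
  then show ?case
    by (auto simp: Let_def consistent_snoc split: action.splits if_splits)
qed

text \<open>A player influences the run only through the bits it sends on its channel, and by
  consistency the new input would have sent the same ones. This yields the rectangle
  property.\<close>

lemma transcript_upd:
  assumes "consistent P i a (view i (transcript P x C))" "m \<le> C"
  shows "transcript P (x(i := a)) m = transcript P x m"
  using assms(2)
proof (induction m)
  case (Suc m)
  have eq: "transcript P (x(i := a)) m = transcript P x m"
    by (rule Suc.IH) (use Suc.prems in simp)
  show ?case
    using consistent_transcript_mono[OF assms(1) Suc.prems]
    unfolding transcript_Suc eq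
    by (cases "coordinator P (transcript P x m)") (auto simp: consistent_snoc)
qed simp

lemma length_transcript: "length (transcript P x m) \<le> m"
  by (induction m) (auto simp: Let_def split: action.split)

lemma length_view: "length (view i t) \<le> length t"
  by (simp add: view_def)

text \<open>Every bit travels on one channel only, so the costs of the channels add up instead of
  being counted \<open>s\<close> times.\<close>

lemma sum_length_view: "(\<Sum>i<s. length (view i t)) \<le> length t"
proof (induction t rule: rev_induct)
  case (snoc e t)
  obtain k e' where e: "e = (k, e')" by (cases e)
  have "(\<Sum>i<s. length (view i (t @ [e]))) = (\<Sum>i<s. length (view i t) + (if k = i then 1 else 0))"
    by (intro sum.cong) (auto simp: e)
  also have "\<dots> \<le> length t + 1"
    using snoc by (simp add: sum.distrib)
  finally show ?case by simp
qed simp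

section \<open>Column laws as mixtures of latent modes\<close>

definition latent_column :: "nat \<Rightarrow> latent \<Rightarrow> bool \<Rightarrow> bool \<Rightarrow> nat set" where
  "latent_column i l a b = (if own_bit i l a then insert i (other_bits i l b) else other_bits i l b)"

lemma not_in_other_bits: "i \<notin> other_bits i l b"
  by (cases l) auto

lemma cube_mean_cong:
  assumes "\<And>\<alpha> \<beta>. \<alpha> \<subseteq> J \<Longrightarrow> \<beta> \<subseteq> J \<Longrightarrow> f \<alpha> \<beta> = f' \<alpha> \<beta>"
  shows "cube_mean J f = cube_mean J f'"
  unfolding cube_mean_def using assms by (intro arg_cong2[of _ _ _ _ "(/)"] sum.cong) auto

lemma cube_mean_insert:
  assumes "finite J" "j \<notin> J"
  shows "cube_mean (insert j J) f =
    (cube_mean J f + cube_mean J (\<lambda>\<alpha> \<beta>. f (insert j \<alpha>) \<beta>) + cube_mean J (\<lambda>\<alpha> \<beta>. f \<alpha> (insert j \<beta>))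
      + cube_mean J (\<lambda>\<alpha> \<beta>. f (insert j \<alpha>) (insert j \<beta>))) / 4"
proof -
  have split: "(\<Sum>\<alpha>\<in>Pow (insert j J). g \<alpha>) = (\<Sum>\<alpha>\<in>Pow J. g \<alpha>) + (\<Sum>\<alpha>\<in>Pow J. g (insert j \<alpha>))"
    for g :: "'a set \<Rightarrow> real"
  proof -
    have "inj_on (insert j) (Pow J)" using assms by (auto simp: inj_on_def)
    moreover have "Pow J \<inter> insert j ` Pow J = {}" using assms by auto
    ultimately show ?thesis using assms
      by (simp add: Pow_insert sum.union_disjoint sum.reindex o_def)
  qed
  show ?thesis
    unfolding cube_mean_def split sum.distrib using assms by (simp add: add_divide_distrib)
qed

text \<open>\<open>mix\<close> expresses equality of two laws of a single column by testing against
  every \<open>f\<close>; induction on \<open>J\<close> carries it over to the products.\<close>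

lemma prod_mean_mixture:
  assumes J: "finite J"
    and mix: "\<And>f. (\<Sum>c\<in>X. \<kappa> c * f c) =
      (\<Sum>l\<in>L. \<kappa>' l * ((f (latent_column i l False False) + f (latent_column i l True False)
        + f (latent_column i l False True) + f (latent_column i l True True)) / 4))"
  shows "prod_mean \<kappa> X J F =
    prod_mean \<kappa>' L J (\<lambda>d. cube_mean J (\<lambda>\<alpha> \<beta>. F (\<lambda>j\<in>J. latent_column i (d j) (j \<in> \<alpha>) (j \<in> \<beta>))))"
  using J
proof (induction J arbitrary: F rule: finite_induct)
  case empty
  then show ?case by (simp add: prod_mean_empty cube_mean_def)
next
  case (insert j J)
  let ?x = "\<lambda>d \<alpha> \<beta>. \<lambda>j\<in>J. latent_column i (d j) (j \<in> \<alpha>) (j \<in> \<beta>)"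
  define G where "G c = prod_mean \<kappa>' L J (\<lambda>d. cube_mean J (\<lambda>\<alpha> \<beta>. F ((?x d \<alpha> \<beta>)(j := c))))" for c
  have ins: "cube_mean (insert j J) (\<lambda>\<alpha> \<beta>. F (\<lambda>k\<in>insert j J. latent_column i ((d(j := l)) k) (k \<in> \<alpha>) (k \<in> \<beta>))) =
    1 / 4 * (cube_mean J (\<lambda>\<alpha> \<beta>. F ((?x d \<alpha> \<beta>)(j := latent_column i l False False)))
     + cube_mean J (\<lambda>\<alpha> \<beta>. F ((?x d \<alpha> \<beta>)(j := latent_column i l True False)))
     + cube_mean J (\<lambda>\<alpha> \<beta>. F ((?x d \<alpha> \<beta>)(j := latent_column i l False True)))
     + cube_mean J (\<lambda>\<alpha> \<beta>. F ((?x d \<alpha> \<beta>)(j := latent_column i l True True))))" for d l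
  proof -
    have e: "(\<lambda>k\<in>insert j J. latent_column i ((d(j := l)) k) (k \<in> \<alpha>') (k \<in> \<beta>')) =
        (?x d \<alpha> \<beta>)(j := latent_column i l a b)"
      if "\<alpha> \<subseteq> J" "\<beta> \<subseteq> J" "\<alpha>' = (if a then insert j \<alpha> else \<alpha>)" "\<beta>' = (if b then insert j \<beta> else \<beta>)"
      for \<alpha> \<beta> \<alpha>' \<beta>' a b
    proof -
      have "j \<notin> \<alpha>" "j \<notin> \<beta>" using that insert.hyps by auto
      then show ?thesis using that insert.hyps by (auto simp: fun_eq_iff)
    qed
    show ?thesis
      unfolding cube_mean_insert[OF insert.hyps]
      using e[where a = False and b = False] e[where a = True and b = False]
        e[where a = False and b = True] e[where a = True and b = True]
      by (simp cong: cube_mean_cong)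
  qed
  have "prod_mean \<kappa> X (insert j J) F = (\<Sum>c\<in>X. \<kappa> c * G c)"
    unfolding prod_mean_insert[OF insert.hyps] insert.IH G_def ..
  also have "\<dots> = (\<Sum>l\<in>L. \<kappa>' l * ((G (latent_column i l False False) + G (latent_column i l True False)
        + G (latent_column i l False True) + G (latent_column i l True True)) / 4))"
    by (rule mix)
  also have "\<dots> = prod_mean \<kappa>' L (insert j J) (\<lambda>d. cube_mean (insert j J)
      (\<lambda>\<alpha> \<beta>. F (\<lambda>k\<in>insert j J. latent_column i (d k) (k \<in> \<alpha>) (k \<in> \<beta>))))"
    unfolding prod_mean_insert[OF insert.hyps] ins prod_mean_scale prod_mean_add G_def
    by simp
  finally show ?case .
qed

text \<open>The hard distribution of a column: dense with probability 1/10, otherwise empty or a singleton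
  with equal probability. A player holding an element cannot tell whether it is the only one without
  learning which columns are dense.\<close>

definition column_law :: "nat \<Rightarrow> nat set \<Rightarrow> real" where
  "column_law s c = 1 / (10 * 2 ^ s) + 9 / 20 * of_bool (c = {}) + 9 / (20 * real s) * of_bool (\<exists>k. c = {k})"

text \<open>\<open>Fixed\<close> receives what the other modes leave of \<open>column_law\<close>.
  Averaged over \<open>c\<close>, \<open>Alice\<close> yields every column with weight
  \<open>1 / (20 * 2 ^ s)\<close>; \<open>Bob\<close> yields those without \<open>i\<close> with the
  same weight and the empty one with a further 1/40. The dense part has twice that weight on each
  column and the empty column has an extra 9/20, so the remainder is nonnegative.\<close>

definition latent_law :: "nat \<Rightarrow> nat \<Rightarrow> latent \<Rightarrow> real" where
  "latent_law s i l = (case l of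
     Alice c \<Rightarrow> 1 / (20 * 2 ^ s)
   | Bob c \<Rightarrow> 1 / (20 * 2 ^ s)
   | Fixed c \<Rightarrow> column_law s c - 1 / (20 * 2 ^ s) - 1 / (20 * 2 ^ s) * of_bool (i \<notin> c)
       - 1 / 40 * of_bool (c = {}))"

definition latents :: "nat \<Rightarrow> latent set" where
  "latents s = Alice ` Pow {..<s} \<union> Bob ` Pow {..<s} \<union> Fixed ` Pow {..<s}"

lemma column_law_nonneg: "column_law s c \<ge> 0"
  by (simp add: column_law_def)

lemma sum_singletons:
  "(\<Sum>c\<in>Pow {..<s :: nat}. of_bool (\<exists>k. c = {k}) * f c) = (\<Sum>k<s. f {k} :: real)"
proof -
  have "(\<Sum>k<s. f {k}) = sum f ((\<lambda>k. {k}) ` {..<s})"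
    by (simp add: sum.reindex)
  also have "\<dots> = (\<Sum>c\<in>Pow {..<s}. of_bool (\<exists>k. c = {k}) * f c)"
    by (rule sum.mono_neutral_cong_left) auto
  finally show ?thesis by simp
qed

lemma sum_empty_set: "(\<Sum>c\<in>Pow {..<s :: nat}. of_bool (c = {}) * f c) = (f {} :: real)"
proof -
  have "(\<Sum>c\<in>Pow {..<s}. of_bool (c = {}) * f c) = (\<Sum>c\<in>{{}}. f c)"
    by (rule sum.mono_neutral_cong_right) auto
  then show ?thesis by simp
qed

lemma sum_column_law_mult:
  "(\<Sum>c\<in>Pow {..<s}. column_law s c * f c) =
    1 / (10 * 2 ^ s) * (\<Sum>c\<in>Pow {..<s}. f c) + 9 / 20 * f {} + 9 / (20 * real s) * (\<Sum>k<s. f {k})"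
  by (simp only: column_law_def distrib_right sum.distrib mult.assoc sum_distrib_left[symmetric]
      sum_singletons sum_empty_set)

lemma sum_column_law: "s \<ge> 1 \<Longrightarrow> sum (column_law s) (Pow {..<s}) = 1"
  using sum_column_law_mult[of s "\<lambda>_. 1"] by (simp add: card_Pow)

lemma finite_latents: "finite (latents s)"
  by (simp add: latents_def)

lemma sum_latents:
  "(\<Sum>l\<in>latents s. f l) = (\<Sum>c\<in>Pow {..<s}. f (Alice c)) + (\<Sum>c\<in>Pow {..<s}. f (Bob c))
    + (\<Sum>c\<in>Pow {..<s}. f (Fixed c) :: real)"
proof -
  have "(\<Sum>l\<in>latents s. f l) = sum f (Alice ` Pow {..<s}) + sum f (Bob ` Pow {..<s}) + sum f (Fixed ` Pow {..<s})"
    unfolding latents_def by (subst sum.union_disjoint; (subst sum.union_disjoint)?; auto)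
  then show ?thesis by (simp add: sum.reindex inj_on_def)
qed

lemma column_law_mixture:
  assumes i: "i < s"
  shows "(\<Sum>c\<in>Pow {..<s}. column_law s c * f c) =
      (\<Sum>l\<in>latents s. latent_law s i l * ((f (latent_column i l False False) + f (latent_column i l True False)
        + f (latent_column i l False True) + f (latent_column i l True True)) / 4))"
proof -
  let ?X = "Pow {..<s}"
  define k0 :: real where "k0 = 1 / (20 * 2 ^ s)"
  have k0: "2 ^ s * k0 = 1 / 20" by (simp add: k0_def)
  have A: "(\<Sum>c\<in>?X. f (insert i c) + f (c - {i})) = 2 * (\<Sum>c\<in>?X. f c)"
    using i by (intro sum_Pow_resample) auto
  have B: "(\<Sum>c\<in>?X. f (c - {i})) = 2 * (\<Sum>c\<in>?X. of_bool (i \<notin> c) * f c)"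
    using sum_Pow_resample[of "{..<s}" i "\<lambda>c. of_bool (i \<notin> c) * f c"] i by simp
  have "(\<Sum>l\<in>latents s. latent_law s i l * ((f (latent_column i l False False) + f (latent_column i l True False)
        + f (latent_column i l False True) + f (latent_column i l True True)) / 4)) =
    (\<Sum>c\<in>?X. k0 * ((f (insert i c) + f (c - {i})) / 2)) + (\<Sum>c\<in>?X. k0 * ((f {} + f (c - {i})) / 2))
    + (\<Sum>c\<in>?X. (column_law s c - k0 - k0 * of_bool (i \<notin> c) - 1 / 40 * of_bool (c = {})) * f c)"
    unfolding sum_latents
  proof (intro arg_cong2[of _ _ _ _ "(+)"] sum.cong refl)
    fix c
    have "latent_column i (Fixed c) a b = c" for a b by (auto simp: latent_column_def)
    then show "latent_law s i (Fixed c) * ((f (latent_column i (Fixed c) False False)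
        + f (latent_column i (Fixed c) True False) + f (latent_column i (Fixed c) False True)
        + f (latent_column i (Fixed c) True True)) / 4)
      = (column_law s c - k0 - k0 * of_bool (i \<notin> c) - 1 / 40 * of_bool (c = {})) * f c"
      by (simp add: latent_law_def k0_def)
  qed (simp_all add: latent_law_def k0_def latent_column_def field_simps)
  also have "\<dots> = k0 / 2 * (\<Sum>c\<in>?X. f (insert i c) + f (c - {i}))
      + (2 ^ s * k0 / 2 * f {} + k0 / 2 * (\<Sum>c\<in>?X. f (c - {i})))
      + ((\<Sum>c\<in>?X. column_law s c * f c) - k0 * (\<Sum>c\<in>?X. f c)
         - k0 * (\<Sum>c\<in>?X. of_bool (i \<notin> c) * f c) - 1 / 40 * (\<Sum>c\<in>?X. of_bool (c = {}) * f c))"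
    by (simp add: left_diff_distrib sum_subtractf sum.distrib sum_distrib_left algebra_simps
        add_divide_distrib card_Pow del: sum_mult_of_bool_eq sum_of_bool_mult_eq)
  also have "\<dots> = (\<Sum>c\<in>?X. column_law s c * f c)"
    unfolding A B sum_empty_set k0 by simp
  finally show ?thesis by simp
qed

lemma sum_latent_law:
  assumes "i < s"
  shows "sum (latent_law s i) (latents s) = 1"
  using column_law_mixture[OF assms, of "\<lambda>_. 1"] sum_column_law[of s] assms by simp

lemma latent_law_nonneg: "latent_law s i l \<ge> 0"
  by (cases l) (auto simp: latent_law_def column_law_def field_simps)

section \<open>Lower bound for approximate unions\<close>

definition player_inputs :: "(nat \<Rightarrow> 'e set \<Rightarrow> 'in) \<Rightarrow> 'e set \<Rightarrow> ('e \<Rightarrow> nat set) \<Rightarrow> nat \<Rightarrow> 'in" where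
  "player_inputs g J x = (\<lambda>k. g k {j\<in>J. k \<in> x j})"

abbreviation column_mean :: "nat \<Rightarrow> 'e set \<Rightarrow> (('e \<Rightarrow> nat set) \<Rightarrow> real) \<Rightarrow> real" where
  "column_mean s \<equiv> prod_mean (column_law s) (Pow {..<s})"

lemma latent_column_Fixed [simp]: "latent_column i (Fixed c) a b = c"
  by (auto simp: latent_column_def)

text \<open>The factor 1/20 is the total weight of the modes \<open>Alice c\<close>, and likewise of
  the modes \<open>Bob c\<close>.\<close>

lemma single_channel_bound:
  fixes g :: "nat \<Rightarrow> 'e set \<Rightarrow> 'in" and P :: "('in, 'out) protocol" and reports :: "transcript \<Rightarrow> 'e set"
    and J :: "'e set" and C :: nat
  defines "tr x \<equiv> transcript P (player_inputs g J x) C"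
  assumes J: "finite J" and i: "i < s" and t: "0 < t" "t \<le> 1 / 6"
  shows "1 / 20 * (\<Sum>j\<in>J. column_mean s J (\<lambda>x.
        of_bool (j \<in> reports (tr (x(j := {i})))) - of_bool (j \<in> reports (tr (x(j := {}))))))
    \<le> 16 * ln 8 / t * (column_mean s J (\<lambda>x. real (length (view i (tr x)))) + 1)
      + 2 * t * (1 / 20) * card J"
proof -
  define run where "run y b = transcript P ((player_inputs g J b)(i := g i y)) C" for y b
  define W where "W = {w :: view. length w \<le> C}"
  define Ac where "Ac w y = consistent P i (g i y) w" for w y
  \<comment> \<open>\<open>Bc\<close> asks for some input of player \<open>i\<close> that produces
    the view, and \<open>Z\<close> picks one. By \<open>run_eq\<close> any two such inputs give the
    same run, so the choice is immaterial.\<close>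
  define Bc where "Bc w b = (\<exists>y. view i (run y b) = w)" for w b
  define Z where "Z w b = reports (run (SOME y. view i (run y b) = w) b)" for w b
  have W_view: "view i (run y b) \<in> W" for y b
    unfolding W_def run_def using length_view length_transcript order_trans by blast
  have run_eq: "run y b = run y' b" if "Ac (view i (run y' b)) y" for y y' b
  proof -
    have "consistent P i (g i y) (view i (transcript P ((player_inputs g J b)(i := g i y')) C))"
      using that by (simp add: Ac_def run_def)
    from transcript_upd[OF this order_refl] show ?thesis by (simp add: run_def)
  qed
  have Ac_own: "Ac (view i (run y b)) y" for y b
    unfolding Ac_def run_def
    using consistent_view[of P i "(player_inputs g J b)(i := g i y)" C] by simp
  have char: "w \<in> W \<and> Ac w y \<and> Bc w b \<longleftrightarrow> w = view i (run y b)" for w y b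
    using run_eq Ac_own W_view unfolding Bc_def by metis
  have UNIV_party: "(UNIV :: party set) = {Coordinator, Player}"
    using party.exhaust by auto
  have "finite (UNIV :: (party \<times> bool) set)"
    by (simp add: UNIV_Times_UNIV[symmetric] UNIV_party del: UNIV_Times_UNIV)
  from finite_lists_length_le[OF this, of C] have "finite W" by (simp add: W_def)
  then interpret two_party J i W C Ac Bc Z
    using J by (unfold_locales; (simp add: char)?) (simp add: W_def)
  have ch: "channel y b = view i (run y b)" for y b
    using channel[of "view i (run y b)" y b] char[of "view i (run y b)" y b] by simp
  have Z: "Z (channel y b) b = reports (run y b)" for y b
  proof -
    have "view i (run (SOME y'. view i (run y' b) = view i (run y b)) b) = view i (run y b)"
      by (rule someI) (rule refl)
    then show ?thesis unfolding Z_def ch using run_eq Ac_own by metis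
  qed
  let ?x = "\<lambda>d \<alpha> \<beta>. \<lambda>k\<in>J. latent_column i (d k) (k \<in> \<alpha>) (k \<in> \<beta>)"
  have run_x: "run (astr d \<alpha>) (bstr d \<beta>) = tr (?x d \<alpha> \<beta>)" for d \<alpha> \<beta>
  proof -
    have "(player_inputs g J (bstr d \<beta>))(i := g i (astr d \<alpha>)) = player_inputs g J (?x d \<alpha> \<beta>)"
    proof (rule ext)
      fix k
      show "((player_inputs g J (bstr d \<beta>))(i := g i (astr d \<alpha>))) k = player_inputs g J (?x d \<alpha> \<beta>) k"
      proof (cases "k = i")
        case True
        have "{j\<in>J. i \<in> ?x d \<alpha> \<beta> j} = astr d \<alpha>"
          by (auto simp: astr_def latent_column_def not_in_other_bits split: if_splits)
        then show ?thesis using True by (simp add: player_inputs_def)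
      next
        case False
        have "{j\<in>J. k \<in> ?x d \<alpha> \<beta> j} = {j\<in>J. k \<in> bstr d \<beta> j}"
          using False by (auto simp: bstr_def latent_column_def split: if_splits)
        then show ?thesis using False by (simp add: player_inputs_def)
      qed
    qed
    then show ?thesis by (simp add: run_def tr_def)
  qed
  note mixture = prod_mean_mixture[OF J, where \<kappa> = "column_law s" and X = "Pow {..<s}"
      and \<kappa>' = "latent_law s i" and L = "latents s" and i = i, OF column_law_mixture[OF i]]
  have rep: "prod_mean (latent_law s i) (latents s) J (\<lambda>d. reported (d(j := Fixed c)) j)
      = column_mean s J (\<lambda>x. of_bool (j \<in> reports (tr (x(j := c)))))" if j: "j \<in> J" for j c
  proof -
    have "?x (d(j := Fixed c)) \<alpha> \<beta> = (?x d \<alpha> \<beta>)(j := c)" for d \<alpha> \<beta>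
      using j by (auto simp: fun_eq_iff)
    then show ?thesis unfolding mixture reported_def Z run_x by simp
  qed
  have "1 / (20 * 2 ^ s) * real (card (Pow {..<s})) * (\<Sum>j\<in>J. prod_mean (latent_law s i) (latents s) J (\<lambda>d.
      reported (d(j := Fixed {i})) j - reported (d(j := Fixed {})) j))
    \<le> 16 * ln 8 / t * (prod_mean (latent_law s i) (latents s) J (\<lambda>d.
        cube_mean J (\<lambda>\<alpha> \<beta>. real (length (channel (astr d \<alpha>) (bstr d \<beta>))))) + 1)
      + 2 * t * (1 / (20 * 2 ^ s) * real (card (Pow {..<s}))) * card J"
    by (rule sum_reported_diff_le[OF finite_latents sum_latent_law[OF i] latent_law_nonneg _ _ _ _ _ _ t])
       (auto simp: latents_def latent_law_def)
  moreover have "1 / (20 * 2 ^ s) * real (card (Pow {..<s})) = 1 / 20"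
    by (simp add: card_Pow)
  moreover have "(\<Sum>j\<in>J. prod_mean (latent_law s i) (latents s) J (\<lambda>d.
      reported (d(j := Fixed {i})) j - reported (d(j := Fixed {})) j)) =
    (\<Sum>j\<in>J. column_mean s J (\<lambda>x.
        of_bool (j \<in> reports (tr (x(j := {i})))) - of_bool (j \<in> reports (tr (x(j := {}))))))"
    by (intro sum.cong refl) (simp only: prod_mean_diff rep)
  moreover have "prod_mean (latent_law s i) (latents s) J (\<lambda>d.
        cube_mean J (\<lambda>\<alpha> \<beta>. real (length (channel (astr d \<alpha>) (bstr d \<beta>))))) =
      column_mean s J (\<lambda>x. real (length (view i (tr x))))"
    by (simp only: mixture ch run_x)
  ultimately show ?thesis by (simp only:)
qed

text \<open>The averaging half of Yao's principle: the mean over the coins of the success weight is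
  at least \<open>p\<close>, so some deterministic protocol attains \<open>p\<close>.\<close>

lemma exists_good_protocol:
  fixes M :: "'p pmf"
  assumes X: "finite X" and \<kappa>: "\<And>x. x \<in> X \<Longrightarrow> \<kappa> x \<ge> 0" "sum \<kappa> X = 1"
    and p: "\<And>x. x \<in> X \<Longrightarrow> measure_pmf.prob M {P. S P x} \<ge> p"
  shows "\<exists>P\<in>set_pmf M. (\<Sum>x\<in>X. \<kappa> x * of_bool (S P x)) \<ge> p"
proof (rule ccontr)
  assume "\<not> ?thesis"
  then have less: "AE P in measure_pmf M. (\<Sum>x\<in>X. \<kappa> x * of_bool (S P x)) < p"
    by (intro AE_pmfI) (simp add: not_le)
  have ind: "of_bool (S P x) = indicator {P. S P x} P" for P x
    by (simp add: indicator_def)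
  have int: "integrable (measure_pmf M) (\<lambda>P. \<kappa> x * of_bool (S P x))" for x
    unfolding ind by (intro integrable_mult_right measure_pmf.integrable_const_bound[where B = 1]) auto
  have "measure_pmf.expectation M (\<lambda>P. \<Sum>x\<in>X. \<kappa> x * of_bool (S P x)) < p"
    by (rule measure_pmf.expectation_less[OF _ less]) (intro Bochner_Integration.integrable_sum int)
  moreover have "measure_pmf.expectation M (\<lambda>P. \<Sum>x\<in>X. \<kappa> x * of_bool (S P x)) =
      (\<Sum>x\<in>X. \<kappa> x * measure_pmf.prob M {P. S P x})"
    by (subst Bochner_Integration.integral_sum[OF int]) (simp add: ind)
  moreover have "\<dots> \<ge> (\<Sum>x\<in>X. \<kappa> x * p)"
    using \<kappa>(1) p by (intro sum_mono mult_left_mono) auto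
  moreover have "(\<Sum>x\<in>X. \<kappa> x * p) = p" by (simp add: sum_distrib_right[symmetric] \<kappa>)
  ultimately show False by simp
qed

text \<open>The margin 1/10 forces \<open>S\<close>, the sum over players and elements of how much
  more often a singleton is reported than an empty column, to be at least
  \<open>2 / 9 * (s * card J)\<close>. \<open>single_channel_bound\<close> converts each player's
  share into length of its view.\<close>

theorem approximate_union_lower_bound:
  fixes g :: "nat \<Rightarrow> 'e set \<Rightarrow> 'in" and M :: "('in, 'out) protocol pmf" and dec :: "'out \<Rightarrow> 'e set"
  assumes M: "randomized_protocol s I R C M" and J: "finite J" and s: "s \<ge> 1"
    and legal: "\<And>x. x \<in> J \<rightarrow>\<^sub>E Pow {..<s} \<Longrightarrow> player_inputs g J x \<in> I"
    and sound: "\<And>x h j. x \<in> J \<rightarrow>\<^sub>E Pow {..<s} \<Longrightarrow> R (player_inputs g J x) h \<Longrightarrow>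
      j \<in> J \<Longrightarrow> j \<in> dec h \<Longrightarrow> x j \<noteq> {}"
    and complete: "\<And>x h. x \<in> J \<rightarrow>\<^sub>E Pow {..<s} \<Longrightarrow> R (player_inputs g J x) h \<Longrightarrow>
      60 * card {j\<in>J. x j \<noteq> {} \<and> j \<notin> dec h} \<le> card J"
  shows "real s * real (card J) \<le> 51840 * ln 8 * (real C + real s)"
proof -
  let ?X = "J \<rightarrow>\<^sub>E Pow {..<s}"
  let ?\<mu> = "\<lambda>x. \<Prod>j\<in>J. column_law s (x j)"
  define good where "good P x \<longleftrightarrow> (\<exists>h. outputs P (player_inputs g J x) C h \<and> R (player_inputs g J x) h)"
    for P x
  have sum_\<mu>: "sum ?\<mu> ?X = 1"
    using prod_mean_const[OF J, of "Pow {..<s}" "column_law s" 1] sum_column_law[OF s]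
    by (simp add: prod_mean_def)
  have "\<exists>P\<in>set_pmf M. (\<Sum>x\<in>?X. ?\<mu> x * of_bool (good P x)) \<ge> 2 / 3"
  proof (rule exists_good_protocol)
    show "finite ?X" using J by (intro finite_PiE) auto
    show "measure_pmf.prob M {P. good P x} \<ge> 2 / 3" if "x \<in> ?X" for x
      using M legal[OF that] by (auto simp: randomized_protocol_def good_def)
  qed (auto intro: prod_nonneg column_law_nonneg sum_\<mu>)
  then obtain P where P: "column_mean s J (\<lambda>x. of_bool (good P x)) \<ge> 2 / 3"
    by (auto simp: prod_mean_def)
  define tr where "tr x = transcript P (player_inputs g J x) C" for x
  define reports where "reports t = (case coordinator P t of Output h \<Rightarrow> dec h | _ \<Rightarrow> {})" for t
  define r where "r j x = (of_bool (j \<in> reports (tr x)) :: real)" for j x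
  define err where "err j x = of_bool (x j = {}) * r j x + of_bool (x j \<noteq> {}) * (1 - r j x)" for j x
  let ?E = "column_mean s J"
  let ?m = "real (card J)"
  have r01: "0 \<le> r j x" "r j x \<le> 1" for j x by (auto simp: r_def)
  have E_const: "?E (\<lambda>_. a) = a" for a
    by (rule prod_mean_const[OF J]) (use sum_column_law[OF s] in auto)
  have E_mono: "?E F \<le> ?E G" if "\<And>x. x \<in> ?X \<Longrightarrow> F x \<le> G x" for F G
    using that by (intro prod_mean_mono column_law_nonneg) auto
  have E_nonneg: "?E F \<ge> 0" if "\<And>x. F x \<ge> 0" for F
    using E_mono[of "\<lambda>_. 0" F] that E_const by simp
  have upper: "(\<Sum>j\<in>J. ?E (err j)) \<le> ?m * (1 / 60 + 1 / 3)"
  proof -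
    have "(\<Sum>j\<in>J. err j x) \<le> ?m * (1 / 60 + 1) - ?m * of_bool (good P x)" if x: "x \<in> ?X" for x
    proof (cases "good P x")
      case False
      have "(\<Sum>j\<in>J. err j x) \<le> (\<Sum>j\<in>J. 1)"
        by (intro sum_mono) (auto simp: err_def r_def)
      then show ?thesis using False by (simp add: algebra_simps)
    next
      case True
      then obtain h where h: "coordinator P (tr x) = Output h" "R (player_inputs g J x) h"
        by (auto simp: good_def outputs_def tr_def)
      have rep: "reports (tr x) = dec h" by (simp add: reports_def h)
      have "(\<Sum>j\<in>J. err j x) = (\<Sum>j\<in>J. of_bool (x j \<noteq> {} \<and> j \<notin> dec h))"
        using sound[OF x h(2)] by (intro sum.cong) (auto simp: err_def r_def rep)
      also have "\<dots> = real (card {j\<in>J. x j \<noteq> {} \<and> j \<notin> dec h})"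
        using J by (simp add: of_bool_def sum.If_cases Int_def)
      also have "\<dots> \<le> ?m * (1 / 60)" using complete[OF x h(2)] by simp
      finally show ?thesis using True by (simp add: algebra_simps)
    qed
    then have "?E (\<lambda>x. \<Sum>j\<in>J. err j x) \<le> ?E (\<lambda>x. ?m * (1 / 60 + 1) - ?m * of_bool (good P x))"
      by (rule E_mono)
    also have "\<dots> = ?m * (1 / 60 + 1) - ?m * ?E (\<lambda>x. of_bool (good P x))"
      by (simp only: prod_mean_diff prod_mean_scale E_const)
    also have "\<dots> \<le> ?m * (1 / 60 + 1) - ?m * (2 / 3)"
      using P by (intro diff_left_mono mult_left_mono) auto
    finally show ?thesis by (simp add: prod_mean_sum algebra_simps)
  qed
  have lower: "?E (err j) \<ge> 9 / 20 - 9 / (20 * real s) * (\<Sum>i<s. ?E (\<lambda>x. r j (x(j := {i})) - r j (x(j := {}))))"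
    if j: "j \<in> J" for j
  proof -
    have "?E (err j) = (\<Sum>c\<in>Pow {..<s}. column_law s c * ?E (\<lambda>x. err j (x(j := c))))"
      by (rule prod_mean_resample[OF J j sum_column_law[OF s]])
    also have "\<dots> = 1 / (10 * 2 ^ s) * (\<Sum>c\<in>Pow {..<s}. ?E (\<lambda>x. err j (x(j := c))))
        + 9 / 20 * ?E (\<lambda>x. err j (x(j := {}))) + 9 / (20 * real s) * (\<Sum>k<s. ?E (\<lambda>x. err j (x(j := {k}))))"
      by (rule sum_column_law_mult)
    \<comment> \<open>Errors on dense columns are discarded; dense columns are there only to supply
      the modes \<open>Alice\<close> and \<open>Bob\<close>.\<close>
    also have "\<dots> \<ge> 9 / 20 * ?E (\<lambda>x. err j (x(j := {}))) + 9 / (20 * real s) * (\<Sum>k<s. ?E (\<lambda>x. err j (x(j := {k}))))"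
    proof -
      have "err j x \<ge> 0" for x using r01[of j x] by (auto simp: err_def)
      then have "1 / (10 * 2 ^ s) * (\<Sum>c\<in>Pow {..<s}. ?E (\<lambda>x. err j (x(j := c)))) \<ge> 0"
        by (intro mult_nonneg_nonneg sum_nonneg E_nonneg) auto
      then show ?thesis by linarith
    qed
    also have "?E (\<lambda>x. err j (x(j := {}))) = ?E (\<lambda>x. r j (x(j := {})))"
      by (intro prod_mean_cong) (simp add: err_def)
    also have "(\<Sum>k<s. ?E (\<lambda>x. err j (x(j := {k})))) = s - (\<Sum>k<s. ?E (\<lambda>x. r j (x(j := {k}))))"
    proof -
      have "?E (\<lambda>x. err j (x(j := {k}))) = ?E (\<lambda>x. 1 - r j (x(j := {k})))" for k
        by (intro prod_mean_cong) (simp add: err_def)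
      then show ?thesis by (simp only: prod_mean_diff E_const sum_subtractf) simp
    qed
    also have "9 / 20 * ?E (\<lambda>x. r j (x(j := {}))) + 9 / (20 * real s) * (s - (\<Sum>k<s. ?E (\<lambda>x. r j (x(j := {k}))))) =
        9 / 20 - 9 / (20 * real s) * (\<Sum>i<s. ?E (\<lambda>x. r j (x(j := {i})) - r j (x(j := {}))))"
      unfolding prod_mean_diff sum_subtractf using s by (simp add: field_simps)
    finally show ?thesis .
  qed
  define S where "S = (\<Sum>j\<in>J. \<Sum>i<s. ?E (\<lambda>x. r j (x(j := {i})) - r j (x(j := {}))))"
  have "9 / 20 * ?m - 9 / (20 * real s) * S =
      (\<Sum>j\<in>J. 9 / 20 - 9 / (20 * real s) * (\<Sum>i<s. ?E (\<lambda>x. r j (x(j := {i})) - r j (x(j := {})))))"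
    unfolding S_def sum_subtractf sum_distrib_left[symmetric] by simp
  also have "\<dots> \<le> (\<Sum>j\<in>J. ?E (err j))"
    by (intro sum_mono lower)
  finally have "9 / 20 * ?m - 9 / (20 * real s) * S \<le> (\<Sum>j\<in>J. ?E (err j))" .
  then have "9 / 20 * ?m - 9 / (20 * real s) * S \<le> ?m * (1 / 60 + 1 / 3)"
    using upper by (rule order_trans)
  moreover have "9 / 20 * ?m - ?m * (1 / 60 + 1 / 3) = ?m * (1 / 10)" by simp
  ultimately have "9 / (20 * real s) * S \<ge> ?m * (1 / 10)" by argo
  then have S_ge: "S \<ge> 2 / 9 * (s * ?m)" using s by (simp add: field_simps)
  \<comment> \<open>With \<open>t = 1 / 18\<close> the error term sums to
    \<open>s * ?m / 180\<close>, half of the \<open>s * ?m / 90\<close> that \<open>S_ge\<close>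
    provides; 51840 is 288 times 180.\<close>
  have one: "1 / 20 * (\<Sum>j\<in>J. ?E (\<lambda>x. r j (x(j := {i})) - r j (x(j := {}))))
      \<le> 288 * ln 8 * (?E (\<lambda>x. real (length (view i (tr x)))) + 1) + 1 / 180 * ?m" if "i < s" for i
    using single_channel_bound[OF J that, where t = "1 / 18" and P = P and g = g and C = C and reports = reports] unfolding r_def tr_def by simp
  have "1 / 20 * S = (\<Sum>i<s. 1 / 20 * (\<Sum>j\<in>J. ?E (\<lambda>x. r j (x(j := {i})) - r j (x(j := {})))))"
    unfolding S_def by (subst sum.swap) (simp add: sum_distrib_left)
  also have "\<dots> \<le> (\<Sum>i<s. 288 * ln 8 * (?E (\<lambda>x. real (length (view i (tr x)))) + 1) + 1 / 180 * ?m)"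
    by (intro sum_mono one) auto
  also have "\<dots> = 288 * ln 8 * (?E (\<lambda>x. \<Sum>i<s. real (length (view i (tr x)))) + s) + s * ?m / 180"
    by (simp add: sum.distrib prod_mean_sum sum_distrib_left algebra_simps)
  also have "\<dots> \<le> 288 * ln 8 * (C + s) + s * ?m / 180"
  proof -
    have "(\<Sum>i<s. real (length (view i (tr x)))) \<le> C" for x
      unfolding tr_def of_nat_sum[symmetric] of_nat_le_iff
      by (rule order_trans[OF sum_length_view length_transcript])
    then have "?E (\<lambda>x. \<Sum>i<s. real (length (view i (tr x)))) \<le> ?E (\<lambda>x. C)" by (intro E_mono)
    then show ?thesis by (simp add: E_const)
  qed
  finally show ?thesis using S_ge by (simp add: algebra_simps)
qed

section \<open>The layered obstacle graph\<close>

lemma graph_dist_le: "(u, v) \<in> {(x, y). {x, y} \<in> E} ^^ m \<Longrightarrow> graph_dist E u v \<le> enat m"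
  unfolding graph_dist_def by (rule Inf_lower) auto

text \<open>Duality for shortest paths: an integer potential that changes by at most 1 along each
  edge certifies a lower bound, also between different components.\<close>

lemma le_graph_dist:
  fixes \<psi> :: "nat \<Rightarrow> int"
  assumes "\<And>x y. {x, y} \<in> E \<Longrightarrow> \<psi> y \<le> \<psi> x + 1" and b: "\<psi> u + int b \<le> \<psi> v"
  shows "enat b \<le> graph_dist E u v"
proof -
  have "\<psi> v \<le> \<psi> u + int m" if "(u, v) \<in> {(x, y). {x, y} \<in> E} ^^ m" for m v
    using that
  proof (induction m arbitrary: v)
    case (Suc m)
    then obtain w where "(u, w) \<in> {(x, y). {x, y} \<in> E} ^^ m" "{w, v} \<in> E" by auto
    with Suc.IH[of w] assms(1)[of w v] show ?case by simp
  qed simp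
  with b show ?thesis
    unfolding graph_dist_def by (fastforce intro: Inf_greatest)
qed

text \<open>The obstacle product of Abboud and Bodwin. \<open>Sub t v g r\<close> is the \<open>r\<close>-th vertex on the subdivided
  outer edge with label \<open>g\<close> leaving position \<open>v\<close> of layer \<open>t\<close>. At each inner position a complete
  bipartite graph of critical edges joins the ends of the incoming to the starts of the outgoing
  outer edges, and a hub offers a detour that is longer by one.\<close>

datatype ('v, 'd) vertex = Sub nat 'v 'd nat | Hub nat 'v

locale layered_graph =
  fixes V :: "'v set" and D :: "'d set" and step :: "nat \<Rightarrow> 'v \<Rightarrow> 'd \<Rightarrow> 'v" and T :: nat
    and enc :: "('v, 'd) vertex \<Rightarrow> nat" and n :: nat
  assumes finV: "finite V" and finD: "finite D" and T: "T > 0"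
    and step: "t < T \<Longrightarrow> v \<in> V \<Longrightarrow> g \<in> D \<Longrightarrow> step t v g \<in> V"
    and enc_less: "enc a < n"
    and enc_inj: "inj_on enc ({Sub t v g r | t v g r. t < T \<and> v \<in> V \<and> g \<in> D \<and> r \<le> T}
      \<union> {Hub t v | t v. t < T \<and> v \<in> V})"
begin

definition vertices :: "('v, 'd) vertex set" where
  "vertices = {Sub t v g r | t v g r. t < T \<and> v \<in> V \<and> g \<in> D \<and> r \<le> T}
      \<union> {Hub t v | t v. t < T \<and> v \<in> V}"

definition base_arcs :: "(('v, 'd) vertex \<times> ('v, 'd) vertex) set" where
  "base_arcs = {(Sub t v g r, Sub t v g (Suc r)) | t v g r. t < T \<and> v \<in> V \<and> g \<in> D \<and> r < T}
     \<union> {(Sub t v g T, Hub (Suc t) (step t v g)) | t v g. Suc t < T \<and> v \<in> V \<and> g \<in> D}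
     \<union> {(Hub (Suc t) v, Sub (Suc t) v g 0) | t v g. Suc t < T \<and> v \<in> V \<and> g \<in> D}"

text \<open>\<open>v\<close> is the position before step \<open>t\<close>, not the inner position
  where the edge sits: several pairs \<open>(v, g)\<close> may lead there, and the incoming outer
  edge is named by its origin.\<close>

definition critical :: "(nat \<times> 'v \<times> 'd \<times> 'd) set" where
  "critical = {..<T - 1} \<times> V \<times> D \<times> D"

fun critical_arc :: "nat \<times> 'v \<times> 'd \<times> 'd \<Rightarrow> ('v, 'd) vertex \<times> ('v, 'd) vertex" where
  "critical_arc (t, v, g, g') = (Sub t v g T, Sub (Suc t) (step t v g) g' 0)"

definition edge :: "('v, 'd) vertex \<times> ('v, 'd) vertex \<Rightarrow> nat set" where
  "edge p = {enc (fst p), enc (snd p)}"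

definition base_edges :: "nat set set" where
  "base_edges = edge ` base_arcs"

definition critical_edge :: "nat \<times> 'v \<times> 'd \<times> 'd \<Rightarrow> nat set" where
  "critical_edge c = edge (critical_arc c)"

lemma finite_critical: "finite critical" and card_critical: "card critical = (T - 1) * (card V * (card D)\<^sup>2)"
  using finV finD by (simp_all add: critical_def card_cartesian_product power2_eq_square)

lemma base_arcs_vertices: "base_arcs \<subseteq> vertices \<times> vertices"
  using step T unfolding base_arcs_def vertices_def by (auto simp: Suc_le_eq)

lemma critical_arc_vertices: "c \<in> critical \<Longrightarrow> critical_arc c \<in> vertices \<times> vertices"
  using step unfolding critical_def vertices_def by (cases c) auto

lemma enc_eq_iff: "a \<in> vertices \<Longrightarrow> b \<in> vertices \<Longrightarrow> enc a = enc b \<longleftrightarrow> a = b"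
  using enc_inj unfolding vertices_def[symmetric] by (auto dest: inj_onD)

lemma edge_in_all_edges: "p \<in> vertices \<times> vertices \<Longrightarrow> fst p \<noteq> snd p \<Longrightarrow> edge p \<in> all_edges n"
  using enc_less enc_eq_iff by (auto simp: edge_def all_edges_def)

lemma base_edges_subset: "base_edges \<subseteq> all_edges n"
proof -
  have "fst p \<noteq> snd p" if "p \<in> base_arcs" for p using that by (auto simp: base_arcs_def)
  then show ?thesis using base_arcs_vertices edge_in_all_edges by (auto simp: base_edges_def)
qed

lemma critical_edge_in: "c \<in> critical \<Longrightarrow> critical_edge c \<in> all_edges n"
  unfolding critical_edge_def
  by (rule edge_in_all_edges[OF critical_arc_vertices]) (auto simp: critical_def)

lemma edge_eqD:
  assumes "p \<in> vertices \<times> vertices" "p' \<in> vertices \<times> vertices" "edge p = edge p'"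
  shows "p' = p \<or> p' = (snd p, fst p)"
  using assms enc_eq_iff unfolding edge_def doubleton_eq_iff
  by (cases p; cases p') auto

lemma critical_edge_eqD:
  assumes c: "c \<in> critical" and c': "c' \<in> critical" and eq: "critical_edge c = critical_edge c'"
  shows "c = c'"
proof -
  have "critical_arc c' = critical_arc c \<or> critical_arc c' = (snd (critical_arc c), fst (critical_arc c))"
    using edge_eqD[OF critical_arc_vertices[OF c] critical_arc_vertices[OF c']] eq
    by (simp add: critical_edge_def)
  then show ?thesis using T by (cases c; cases c') auto
qed

lemma critical_edge_not_base:
  assumes c: "c \<in> critical"
  shows "critical_edge c \<notin> base_edges"
proof
  assume "critical_edge c \<in> base_edges"
  then obtain p where p: "p \<in> base_arcs" "edge (critical_arc c) = edge p"
    by (auto simp: base_edges_def critical_edge_def)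
  have "p = critical_arc c \<or> p = (snd (critical_arc c), fst (critical_arc c))"
    using edge_eqD[OF critical_arc_vertices[OF c] _ p(2)] base_arcs_vertices p(1) by blast
  then show False using p(1) T by (cases c) (auto simp: base_arcs_def)
qed

end

text \<open>A route is a walk through the layers that is rigid: from a position on it, no other label
  leads to a position from which the end of the route can still be reached (\<open>co\<close>).\<close>

locale rigid_route = layered_graph +
  fixes pos :: "nat \<Rightarrow> 'a" and lab :: "nat \<Rightarrow> 'b" and co :: "nat \<Rightarrow> 'a \<Rightarrow> bool"
  assumes pos_in: "t < T \<Longrightarrow> pos t \<in> V" and lab_in: "t < T \<Longrightarrow> lab t \<in> D"
    and pos_Suc: "t < T \<Longrightarrow> pos (Suc t) = step t (pos t) (lab t)"
    and co_pos: "t \<le> T \<Longrightarrow> co t (pos t)"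
    and co_step: "t < T \<Longrightarrow> v \<in> V \<Longrightarrow> g \<in> D \<Longrightarrow> co (Suc t) (step t v g) \<Longrightarrow> co t v"
    and rigid: "t < T \<Longrightarrow> g \<in> D \<Longrightarrow> co (Suc t) (step t (pos t) g) \<Longrightarrow> g = lab t"
begin

definition crit :: "nat \<Rightarrow> nat \<times> 'a \<times> 'b \<times> 'b" where
  "crit t = (t, pos t, lab t, lab (Suc t))"

definition start :: "('a, 'b) vertex" where "start = Sub 0 (pos 0) (lab 0) 0"

definition finish :: "('a, 'b) vertex" where "finish = Sub (T - 1) (pos (T - 1)) (lab (T - 1)) T"

definition missing :: "(nat \<times> 'a \<times> 'b \<times> 'b) set \<Rightarrow> nat \<Rightarrow> nat" where
  "missing X t = (\<Sum>u<t. of_bool (crit u \<notin> X))"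

lemma missing_Suc: "missing X (Suc t) = missing X t + of_bool (crit t \<notin> X)"
  by (simp add: missing_def)

lemma missing_0: "missing X 0 = 0"
  by (simp add: missing_def)

lemma missing_le: "missing X t \<le> t"
  by (induction t) (simp_all add: missing_Suc missing_0 of_bool_def)

lemma crit_in: "t < T - 1 \<Longrightarrow> crit t \<in> critical"
  using pos_in lab_in by (auto simp: crit_def critical_def)

text \<open>A potential that is 1-Lipschitz on every subgraph with critical edges \<open>X\<close>: height plus an
  excess, which at positions off the route is \<open>T\<close> or \<open>0\<close> according to whether the end of
  the route can still be reached. The excess drops along an outer edge at most by the length \<open>T\<close>
  of its subdivision.\<close>

definition excess_out :: "(nat \<times> 'a \<times> 'b \<times> 'b) set \<Rightarrow> nat \<Rightarrow> 'a \<Rightarrow> 'b \<Rightarrow> nat" where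
  "excess_out X t v g =
     (if v = pos t then if g = lab t then missing X t else missing X (t - 1)
      else if co t v then T else 0)"

text \<open>Arriving at \<open>pos (Suc t)\<close> from off the route gets the larger value
  \<open>missing X (Suc t)\<close>, since the critical edge from there to the route's next label may
  be present even when \<open>crit t\<close> is not.\<close>

definition excess_in :: "(nat \<times> 'a \<times> 'b \<times> 'b) set \<Rightarrow> nat \<Rightarrow> 'a \<Rightarrow> 'b \<Rightarrow> nat" where
  "excess_in X t v g =
     (if step t v g = pos (Suc t) then if v = pos t then missing X t else missing X (Suc t)
      else if co (Suc t) (step t v g) then T else 0)"

fun potential :: "(nat \<times> 'a \<times> 'b \<times> 'b) set \<Rightarrow> ('a, 'b) vertex \<Rightarrow> int" where
  "potential X (Sub t v g r) =
     int (t * (T + 1) + r + max (excess_in X t v g) (excess_out X t v g - r))"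
| "potential X (Hub t v) =
     int (t * (T + 1) + (if v = pos t then missing X (t - 1) else if co t v then T else 0))"

lemma excess_out_le: "t < T \<Longrightarrow> excess_out X t v g \<le> T"
  using missing_le[of X t] missing_le[of X "t - 1"] by (auto simp: excess_out_def)

text \<open>Rigidity enters here. On the route, a foreign label makes the end unreachable and the
  excess falls to 0. Off the route, reachability passes backwards along the step, so an excess at
  the far end is backed by \<open>T\<close> at the near end.\<close>

lemma excess_in_le_out:
  assumes "t < T" "v \<in> V" "g \<in> D"
  shows "excess_in X t v g \<le> excess_out X t v g"
proof (cases "co (Suc t) (step t v g)")
  case False
  then have "step t v g \<noteq> pos (Suc t)" using co_pos[of "Suc t"] assms(1) by auto
  then show ?thesis using False by (simp add: excess_in_def)
next
  case co: True
  show ?thesis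
  proof (cases "v = pos t")
    case True
    then have "g = lab t" using co rigid assms(1,3) by simp
    moreover have "step t v g = pos (Suc t)" using pos_Suc[OF assms(1)] True calculation by simp
    ultimately show ?thesis using True by (simp add: excess_in_def excess_out_def)
  next
    case False
    moreover have "co t v" using co_step[OF assms co] .
    ultimately show ?thesis
      using missing_le[of X "Suc t"] assms(1) by (simp add: excess_in_def excess_out_def)
  qed
qed

lemma potential_out:
  "t < T \<Longrightarrow> v \<in> V \<Longrightarrow> g \<in> D \<Longrightarrow> potential X (Sub t v g 0) = int (t * (T + 1) + excess_out X t v g)"
  using excess_in_le_out[of t v g X] by (simp add: max_def)

lemma potential_in:
  "t < T \<Longrightarrow> v \<in> V \<Longrightarrow> g \<in> D \<Longrightarrow> potential X (Sub t v g T) = int (t * (T + 1) + T + excess_in X t v g)"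
  using excess_out_le[of t X v g] by simp

lemma potential_base_arc:
  assumes "(a, b) \<in> base_arcs"
  shows "\<bar>potential X b - potential X a\<bar> \<le> 1"
proof -
  consider (seg) t v g r where "a = Sub t v g r" "b = Sub t v g (Suc r)" "t < T" "v \<in> V" "g \<in> D" "r < T"
    | (hub_in) t v g where "a = Sub t v g T" "b = Hub (Suc t) (step t v g)" "Suc t < T" "v \<in> V" "g \<in> D"
    | (hub_out) t v g where "a = Hub (Suc t) v" "b = Sub (Suc t) v g 0" "Suc t < T" "v \<in> V" "g \<in> D"
    using assms by (auto simp: base_arcs_def)
  then show ?thesis
  proof cases
    case seg
    then show ?thesis by (auto simp: max_def)
  next
    case hub_in
    then show ?thesis
      using missing_Suc[of X t] unfolding hub_in(1,2)
      by (subst potential_in) (auto simp: excess_in_def)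
  next
    case hub_out
    then show ?thesis
      using missing_Suc[of X t] unfolding hub_out(1,2)
      by (subst potential_out) (auto simp: excess_out_def)
  qed
qed

lemma potential_critical_arc:
  assumes "c \<in> critical" "c \<in> X"
  shows "\<bar>potential X (snd (critical_arc c)) - potential X (fst (critical_arc c))\<bar> \<le> 1"
proof -
  obtain t v g g' where c: "c = (t, v, g, g')" "Suc t < T" "v \<in> V" "g \<in> D" "g' \<in> D"
    using assms by (cases c) (auto simp: critical_def)
  have "excess_out X (Suc t) (step t v g) g' \<le> excess_in X t v g"
    "excess_in X t v g \<le> excess_out X (Suc t) (step t v g) g' + 1"
  proof -
    \<comment> \<open>The route's own critical edge is the only one whose presence in
      \<open>X\<close> matters.\<close>
    have "missing X (Suc t) = missing X t" if "v = pos t" "g = lab t" "g' = lab (Suc t)"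
      using assms(2) that by (simp add: missing_Suc crit_def c)
    moreover have "g = lab t" if "v = pos t" "step t v g = pos (Suc t)"
      using rigid[of t g] co_pos[of "Suc t"] that c by simp
    ultimately show "excess_out X (Suc t) (step t v g) g' \<le> excess_in X t v g"
      "excess_in X t v g \<le> excess_out X (Suc t) (step t v g) g' + 1"
      using missing_Suc[of X t] by (auto simp: excess_in_def excess_out_def)
  qed
  then show ?thesis
    using c potential_in[of t v g X] potential_out[of "Suc t" "step t v g" g' X] step[of t v g]
    by simp
qed

lemma start_finish_vertices: "start \<in> vertices" "finish \<in> vertices"
  using T pos_in lab_in by (auto simp: start_def finish_def vertices_def)

text \<open>\<open>T * (T + 1) - 1\<close> counts \<open>T\<close> outer edges of length
  \<open>T\<close> and the \<open>T - 1\<close> critical edges between them.\<close>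

lemma dist_ge:
  assumes H: "H \<subseteq> base_edges \<union> critical_edge ` critical"
  defines "X \<equiv> {c \<in> critical. critical_edge c \<in> H}"
  shows "enat (T * (T + 1) - 1 + missing X (T - 1)) \<le> graph_dist H (enc start) (enc finish)"
proof (rule le_graph_dist)
  \<comment> \<open>At numbers that encode no vertex the values are arbitrary; no edge of
    \<open>H\<close> meets them.\<close>
  define \<psi> where "\<psi> x = potential X (inv_into vertices enc x)" for x
  have inv: "inv_into vertices enc (enc a) = a" if "a \<in> vertices" for a
    using enc_inj that unfolding vertices_def[symmetric] by (rule inv_into_f_f)
  show "\<psi> y \<le> \<psi> x + 1" if xy: "{x, y} \<in> H" for x y
  proof -
    obtain p where p: "p \<in> vertices \<times> vertices" "{x, y} = edge p"
      "\<bar>potential X (snd p) - potential X (fst p)\<bar> \<le> 1"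
    proof -
      from xy H consider q where "q \<in> base_arcs" "{x, y} = edge q"
        | c where "c \<in> critical" "{x, y} = critical_edge c"
        by (auto simp: base_edges_def)
      then show thesis
      proof cases
        case (1 q)
        then show thesis
          using that[of q] base_arcs_vertices potential_base_arc[of "fst q" "snd q" X] by auto
      next
        case (2 c)
        then have "c \<in> X" using xy by (auto simp: X_def)
        then show thesis
          using that[of "critical_arc c"] 2 potential_critical_arc[of c X] critical_arc_vertices[of c]
          by (simp add: critical_edge_def)
      qed
    qed
    then have "x = enc (fst p) \<and> y = enc (snd p) \<or> x = enc (snd p) \<and> y = enc (fst p)"
      by (simp add: edge_def doubleton_eq_iff)
    then show ?thesis using p by (auto simp: \<psi>_def inv mem_Times_iff)
  qed
  have T1: "T - 1 < T" "(T - 1) * (T + 1) + T = T * (T + 1) - 1"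
    using T by (simp_all add: algebra_simps diff_mult_distrib)
  have "excess_in X (T - 1) (pos (T - 1)) (lab (T - 1)) = missing X (T - 1)"
    using pos_Suc[OF T1(1)] by (simp add: excess_in_def)
  then have "potential X finish = int (T * (T + 1) - 1 + missing X (T - 1))"
    unfolding finish_def using potential_in[OF T1(1) pos_in[OF T1(1)] lab_in[OF T1(1)], of X] T1(2)
    by simp
  moreover have "potential X start = 0"
    unfolding start_def using potential_out[OF T pos_in[OF T] lab_in[OF T], of X]
    by (simp add: excess_out_def missing_def)
  ultimately show "\<psi> (enc start) + int (T * (T + 1) - 1 + missing X (T - 1)) \<le> \<psi> (enc finish)"
    using start_finish_vertices by (simp add: \<psi>_def inv)
qed

text \<open>Walk the route and replace each missing critical edge by two hub edges.\<close>

lemma dist_le: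
  "graph_dist (base_edges \<union> critical_edge ` X) (enc start) (enc finish)
    \<le> enat (T * (T + 1) - 1 + missing X (T - 1))"
proof (rule graph_dist_le)
  let ?R = "{(x, y). {x, y} \<in> base_edges \<union> critical_edge ` X}"
  let ?in = "\<lambda>t r. enc (Sub t (pos t) (lab t) r)"
  have base: "(enc a, enc b) \<in> ?R" if "(a, b) \<in> base_arcs" for a b
    using that by (force simp: base_edges_def edge_def)
  have seg: "(?in t 0, ?in t r) \<in> ?R ^^ r" if "t < T" "r \<le> T" for t r
    using that(2)
  proof (induction r)
    case (Suc r)
    have "(?in t r, ?in t (Suc r)) \<in> ?R"
      by (rule base) (use that(1) Suc.prems pos_in lab_in in \<open>auto simp: base_arcs_def\<close>)
    then show ?case using Suc by (auto intro: relcompI)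
  qed simp
  have cross: "(?in t T, ?in (Suc t) 0) \<in> ?R ^^ (1 + of_bool (crit t \<notin> X))" if t: "Suc t < T" for t
  proof (cases "crit t \<in> X")
    case True
    then have "critical_edge (crit t) \<in> critical_edge ` X" by simp
    then have "(?in t T, ?in (Suc t) 0) \<in> ?R"
      using pos_Suc[of t] t by (simp add: crit_def critical_edge_def edge_def)
    then show ?thesis using True by simp
  next
    case False
    have "(?in t T, enc (Hub (Suc t) (pos (Suc t)))) \<in> ?R"
      by (rule base) (use t pos_in[of t] lab_in[of t] pos_Suc[of t] in \<open>auto simp: base_arcs_def\<close>)
    moreover have "(enc (Hub (Suc t) (pos (Suc t))), ?in (Suc t) 0) \<in> ?R"
      by (rule base) (use t pos_in[of "Suc t"] lab_in[of "Suc t"] in \<open>auto simp: base_arcs_def\<close>)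
    ultimately have "(?in t T, ?in (Suc t) 0) \<in> ?R O ?R" by (rule relcompI)
    then show ?thesis using False by (simp add: numeral_2_eq_2)
  qed
  have reach: "(?in 0 0, ?in t T) \<in> ?R ^^ (t * (T + 1) + T + missing X t)" if "t < T" for t
    using that
  proof (induction t)
    case 0
    then show ?case using seg[of 0 T] by (simp add: missing_def)
  next
    case (Suc t)
    have "(?in 0 0, ?in (Suc t) T) \<in> (?R ^^ (t * (T + 1) + T + missing X t) O
        ?R ^^ (1 + of_bool (crit t \<notin> X))) O ?R ^^ T"
      using Suc.IH Suc.prems cross[of t] seg[of "Suc t" T] by (intro relcompI) auto
    also have "\<dots> = ?R ^^ ((t * (T + 1) + T + missing X t) + (1 + of_bool (crit t \<notin> X)) + T)"
      by (simp only: relpow_add)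
    also have "(t * (T + 1) + T + missing X t) + (1 + of_bool (crit t \<notin> X)) + T =
        Suc t * (T + 1) + T + missing X (Suc t)"
      by (simp add: missing_Suc)
    finally show ?case .
  qed
  have "(T - 1) * (T + 1) + T = T * (T + 1) - 1"
    using T by (simp add: algebra_simps diff_mult_distrib)
  then show "(enc start, enc finish) \<in> ?R ^^ (T * (T + 1) - 1 + missing X (T - 1))"
    using reach[of "T - 1"] T by (simp add: start_def finish_def)
qed

lemma spanner_contains_most:
  assumes X: "X \<subseteq> critical" and H: "additive_spanner n k (base_edges \<union> critical_edge ` X) H"
  shows "card {t. t < T - 1 \<and> crit t \<in> X \<and> critical_edge (crit t) \<notin> H} \<le> k"
proof -
  define Y where "Y = {c \<in> critical. critical_edge c \<in> H}"
  have HG: "H \<subseteq> base_edges \<union> critical_edge ` X" using H by (simp add: additive_spanner_def)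
  then have YX: "Y \<subseteq> X"
    using critical_edge_not_base critical_edge_eqD X unfolding Y_def by blast
  have "enat (T * (T + 1) - 1 + missing Y (T - 1)) \<le> graph_dist H (enc start) (enc finish)"
    unfolding Y_def by (rule dist_ge) (use HG X in blast)
  also have "\<dots> \<le> graph_dist (base_edges \<union> critical_edge ` X) (enc start) (enc finish) + enat k"
    using H enc_less by (simp add: additive_spanner_def)
  also have "\<dots> \<le> enat (T * (T + 1) - 1 + missing X (T - 1)) + enat k"
    by (intro add_right_mono dist_le)
  finally have le: "missing Y (T - 1) \<le> missing X (T - 1) + k" by simp
  have "missing Y (T - 1) = (\<Sum>t<T - 1. of_bool (crit t \<notin> X) + of_bool (crit t \<in> X \<and> crit t \<notin> Y))"
    unfolding missing_def using YX by (intro sum.cong) auto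
  also have "\<dots> = missing X (T - 1) + card {t. t < T - 1 \<and> crit t \<in> X \<and> crit t \<notin> Y}"
    unfolding sum.distrib missing_def
    by (simp add: of_bool_def sum.If_cases Int_def lessThan_def)
  finally have "card {t. t < T - 1 \<and> crit t \<in> X \<and> crit t \<notin> Y} \<le> k" using le by simp
  moreover have "{t. t < T - 1 \<and> crit t \<in> X \<and> critical_edge (crit t) \<notin> H} =
      {t. t < T - 1 \<and> crit t \<in> X \<and> crit t \<notin> Y}"
    using crit_in by (auto simp: Y_def)
  ultimately show ?thesis by simp
qed

end

section \<open>Routes in the grid\<close>

text \<open>Behrend's condition modulo \<open>q\<close>: a member of \<open>D\<close> is an average
  of \<open>l\<close> members only trivially. For \<open>l = 2\<close> it excludes three-term
  progressions.\<close>

definition average_free :: "nat \<Rightarrow> nat \<Rightarrow> nat set \<Rightarrow> bool" where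
  "average_free l q D \<longleftrightarrow> (\<forall>d\<in>D. \<forall>f. (\<forall>i<l. f i \<in> D) \<and> (\<Sum>i<l. f i) mod q = (l * d) mod q
     \<longrightarrow> (\<forall>i<l. f i = d))"

definition reaches :: "nat \<Rightarrow> nat \<Rightarrow> nat set \<Rightarrow> nat \<Rightarrow> nat \<Rightarrow> nat \<Rightarrow> bool" where
  "reaches l q D z r x \<longleftrightarrow> (\<exists>f. (\<forall>i. f i \<in> D) \<and> (x + (\<Sum>i\<in>{r..<l}. f i)) mod q = z)"

lemma reaches_line:
  assumes "r \<le> l" "d \<in> D"
  shows "reaches l q D ((x0 + l * d) mod q) r ((x0 + r * d) mod q)"
proof -
  have "(x0 + r * d) + (\<Sum>i\<in>{r..<l}. d) = x0 + l * d"
    using assms(1) by (simp add: diff_mult_distrib)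
  then have "((x0 + r * d) mod q + (\<Sum>i\<in>{r..<l}. d)) mod q = (x0 + l * d) mod q"
    by (metis mod_add_left_eq)
  then show ?thesis unfolding reaches_def using assms(2) by (intro exI[of _ "\<lambda>_. d"]) simp
qed

lemma reaches_step:
  assumes "r < l" "g \<in> D" "reaches l q D z (Suc r) ((x + g) mod q)"
  shows "reaches l q D z r x"
proof -
  obtain f where f: "\<forall>i. f i \<in> D" "((x + g) mod q + (\<Sum>i\<in>{Suc r..<l}. f i)) mod q = z"
    using assms(3) by (auto simp: reaches_def)
  have "(\<Sum>i\<in>{r..<l}. (f(r := g)) i) = g + (\<Sum>i\<in>{Suc r..<l}. f i)"
    using assms(1) by (subst sum.atLeast_Suc_lessThan) auto
  then have "(x + (\<Sum>i\<in>{r..<l}. (f(r := g)) i)) mod q = z"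
    using f(2) by (simp add: mod_add_left_eq add.assoc)
  then show ?thesis unfolding reaches_def using f(1) assms(2) by (intro exI[of _ "f(r := g)"]) auto
qed

text \<open>The \<open>r\<close> steps \<open>d\<close> already taken, then \<open>g\<close>, then
  the remaining steps form \<open>l\<close> labels whose sum is congruent to \<open>l * d\<close>;
  hence all of them are \<open>d\<close>.\<close>

lemma reaches_rigid:
  assumes free: "average_free l q D" and r: "r < l" and D: "d \<in> D" "g \<in> D"
    and reach: "reaches l q D ((x0 + l * d) mod q) (Suc r) (((x0 + r * d) mod q + g) mod q)"
  shows "g = d"
proof -
  obtain f where f: "\<forall>i. f i \<in> D"
    "(((x0 + r * d) mod q + g) mod q + (\<Sum>i\<in>{Suc r..<l}. f i)) mod q = (x0 + l * d) mod q"
    using reach by (auto simp: reaches_def)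
  define F where "F i = (if i < r then d else if i = r then g else f i)" for i
  have "(\<Sum>i<l. F i) = (\<Sum>i<r. F i) + (\<Sum>i\<in>{r..<l}. F i)"
    using r by (metis atLeast0LessThan less_imp_le_nat sum.atLeastLessThan_concat zero_le)
  also have "(\<Sum>i\<in>{r..<l}. F i) = g + (\<Sum>i\<in>{Suc r..<l}. f i)"
    using r by (subst sum.atLeast_Suc_lessThan) (auto simp: F_def)
  also have "(\<Sum>i<r. F i) = r * d" by (simp add: F_def)
  finally have "x0 + (\<Sum>i<l. F i) = (x0 + r * d + g) + (\<Sum>i\<in>{Suc r..<l}. f i)" by simp
  then have "(x0 + (\<Sum>i<l. F i)) mod q = (x0 + l * d) mod q"
    using f(2) by (metis mod_add_left_eq)
  then have "int q dvd int (x0 + (\<Sum>i<l. F i)) - int (x0 + l * d)"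
    by (metis mod_eq_dvd_iff zmod_int)
  then have "int q dvd int (\<Sum>i<l. F i) - int (l * d)" by simp
  then have "(\<Sum>i<l. F i) mod q = (l * d) mod q"
    by (metis mod_eq_dvd_iff zmod_int of_nat_eq_iff)
  moreover have "\<forall>i<l. F i \<in> D" using f(1) D by (simp add: F_def)
  ultimately have "F r = d" using free D(1) r unfolding average_free_def by blast
  then show ?thesis by (simp add: F_def)
qed

text \<open>Two alternating directions are needed because a critical edge joins two freely chosen
  labels, while a route with a single label would only contain edges with
  \<open>g = g'\<close>.\<close>

definition grid_step :: "nat \<Rightarrow> nat \<Rightarrow> nat \<times> nat \<Rightarrow> nat \<Rightarrow> nat \<times> nat" where
  "grid_step q t v g = (if even t then ((fst v + g) mod q, snd v) else (fst v, (snd v + g) mod q))"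

text \<open>\<open>(t + 1) div 2\<close> and \<open>t div 2\<close> count the even and the odd steps
  before \<open>t\<close>.\<close>

definition route_pos :: "nat \<Rightarrow> nat \<times> nat \<Rightarrow> nat \<Rightarrow> nat \<Rightarrow> nat \<Rightarrow> nat \<times> nat" where
  "route_pos q v d e t = ((fst v + (t + 1) div 2 * d) mod q, (snd v + t div 2 * e) mod q)"

definition route_lab :: "nat \<Rightarrow> nat \<Rightarrow> nat \<Rightarrow> nat" where
  "route_lab d e t = (if even t then d else e)"

definition route_co :: "nat \<Rightarrow> nat \<Rightarrow> nat set \<Rightarrow> nat \<times> nat \<Rightarrow> nat \<Rightarrow> nat \<Rightarrow> nat \<Rightarrow> nat \<times> nat \<Rightarrow> bool" where
  "route_co l q D v d e t w \<longleftrightarrow>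
     reaches l q D ((fst v + l * d) mod q) ((t + 1) div 2) (fst w) \<and>
     reaches l q D ((snd v + l * e) mod q) (t div 2) (snd w)"

lemma grid_rigid_route:
  assumes G: "layered_graph ({..<q} \<times> {..<q}) D (grid_step q) (2 * l) enc n"
    and q: "q > 0" and free: "average_free l q D" and D: "d \<in> D" "e \<in> D"
  shows "rigid_route ({..<q} \<times> {..<q}) D (grid_step q) (2 * l) enc n
    (route_pos q v d e) (route_lab d e) (route_co l q D v d e)"
proof -
  interpret layered_graph "{..<q} \<times> {..<q}" D "grid_step q" "2 * l" enc n by (rule G)
  show ?thesis
  proof
    fix t :: nat
    show "route_pos q v d e t \<in> {..<q} \<times> {..<q}" using q by (simp add: route_pos_def)
    show "route_lab d e t \<in> D" using D by (simp add: route_lab_def)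
    show "route_pos q v d e (Suc t) = grid_step q t (route_pos q v d e t) (route_lab d e t)"
      by (cases "even t")
         (auto simp: route_pos_def grid_step_def route_lab_def mod_add_left_eq mod_add_right_eq algebra_simps elim!: evenE oddE)
  next
    fix t assume "t \<le> 2 * l"
    then show "route_co l q D v d e t (route_pos q v d e t)"
      unfolding route_co_def route_pos_def fst_conv snd_conv
      by (intro conjI reaches_line D) auto
  next
    fix t w g assume t: "t < 2 * l" and g: "g \<in> D"
      and co: "route_co l q D v d e (Suc t) (grid_step q t w g)"
    show "route_co l q D v d e t w"
    proof (cases "even t")
      case True
      then have "(t + 1) div 2 < l" "(Suc t + 1) div 2 = Suc ((t + 1) div 2)" "Suc t div 2 = t div 2"
        using t by (auto elim!: evenE)
      then show ?thesis
        using co g True reaches_step[of "(t + 1) div 2" l g D q _ "fst w"]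
        by (simp add: route_co_def grid_step_def)
    next
      case False
      then have "t div 2 < l" "(Suc t + 1) div 2 = (t + 1) div 2" "Suc t div 2 = Suc (t div 2)"
        using t by (auto elim!: oddE)
      then show ?thesis
        using co g False reaches_step[of "t div 2" l g D q _ "snd w"]
        by (simp add: route_co_def grid_step_def)
    qed
  next
    fix t g assume t: "t < 2 * l" and g: "g \<in> D"
      and co: "route_co l q D v d e (Suc t) (grid_step q t (route_pos q v d e t) g)"
    show "g = route_lab d e t"
    proof (cases "even t")
      case True
      then have "(t + 1) div 2 < l" "(Suc t + 1) div 2 = Suc ((t + 1) div 2)"
        using t by (auto elim!: evenE)
      then show ?thesis
        using co reaches_rigid[OF free _ D(1) g, of "(t + 1) div 2" "fst v"] True
        by (simp add: route_co_def grid_step_def route_pos_def route_lab_def)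
    next
      case False
      then have "t div 2 < l" "Suc t div 2 = Suc (t div 2)"
        using t by (auto elim!: oddE)
      then show ?thesis
        using co reaches_rigid[OF free _ D(2) g, of "t div 2" "snd v"] False
        by (simp add: route_co_def grid_step_def route_pos_def route_lab_def)
    qed
  qed
qed

lemma ex_mod_add_eq: "(x :: nat) < q \<Longrightarrow> \<exists>y<q. (y + a) mod q = x"
proof -
  assume x: "x < q"
  define y where "y = (x + q * a - a) mod q"
  have "a \<le> x + q * a" using x by (cases q) auto
  then have "(y + a) mod q = (x + q * a) mod q"
    unfolding y_def by (metis le_add_diff_inverse2 mod_add_left_eq)
  then show ?thesis using x by (intro exI[of _ y]) (simp add: y_def)
qed

lemma grid_encoding:
  fixes D :: "nat set"
  assumes q: "q > 0" and D: "D \<subseteq> {..<q}" and T: "T > 0" and n: "T * (T + 2) * q ^ 3 \<le> n"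
  shows "\<exists>enc. layered_graph ({..<q} \<times> {..<q}) D (grid_step q) T enc n"
proof -
  let ?V = "{..<q} \<times> {..<q}"
  define A where "A = (\<lambda>(t, v, g, r). Sub t v g r) ` ({..<T} \<times> ?V \<times> D \<times> {..T})"
  define B where "B = (\<lambda>(t, v). Hub t v :: (nat \<times> nat, nat) vertex) ` ({..<T} \<times> ?V)"
  have vert: "{Sub t v g r | t v g r. t < T \<and> v \<in> ?V \<and> g \<in> D \<and> r \<le> T} \<union> {Hub t v | t v. t < T \<and> v \<in> ?V} = A \<union> B"
    by (auto simp: A_def B_def image_iff)
  have fD: "finite D" using D finite_subset by blast
  have cD: "card D \<le> q" using card_mono[OF _ D] by simp
  have "card (A \<union> B) \<le> card A + card B" by (rule card_Un_le)
  also have "\<dots> \<le> card ({..<T} \<times> ?V \<times> D \<times> {..T}) + card ({..<T} \<times> ?V)"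
    unfolding A_def B_def using fD by (intro add_mono card_image_le) auto
  also have "\<dots> = T * (q * q) * (card D * (T + 1) + 1)"
    by (simp add: card_cartesian_product algebra_simps)
  also have "\<dots> \<le> T * (q * q) * (q * (T + 1) + q)"
    using cD q by (intro mult_left_mono add_mono mult_right_mono) auto
  also have "\<dots> = T * (T + 2) * q ^ 3" by (simp add: algebra_simps power3_eq_cube)
  finally have card: "card (A \<union> B) \<le> card {..<n}" using n by simp
  have "finite (A \<union> B)" using fD by (simp add: A_def B_def)
  then obtain f where f: "f ` (A \<union> B) \<subseteq> {..<n}" "inj_on f (A \<union> B)"
    using card_le_inj[OF _ _ card] by blast
  have n0: "n > 0" using n q T by (metis gr0I le_zero_eq mult_is_0 power_not_zero add_is_0 not_gr0 zero_neq_numeral)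
  define enc where "enc a = (if a \<in> A \<union> B then f a else 0)" for a
  have "layered_graph ?V D (grid_step q) T enc n"
  proof
    show "inj_on enc ({Sub t v g r | t v g r. t < T \<and> v \<in> ?V \<and> g \<in> D \<and> r \<le> T} \<union> {Hub t v | t v. t < T \<and> v \<in> ?V})"
      unfolding vert using f(2) by (auto simp: enc_def inj_on_def)
    show "enc a < n" for a using f(1) n0 by (auto simp: enc_def)
  qed (use T fD q in \<open>auto simp: grid_step_def\<close>)
  then show ?thesis by blast
qed

section \<open>Reduction of approximate union to spanners\<close>

lemma spanner_randomized_protocol:
  "\<exists>M. randomized_protocol s (edge_inputs n s) (\<lambda>E H. additive_spanner n \<beta> (\<Union>i<s. E i) H)
     (spanner_complexity n s \<beta>) M"
proof -
  define Q where "Q C \<longleftrightarrow> (\<exists>M. randomized_protocol s (edge_inputs n s)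
    (\<lambda>E H. additive_spanner n \<beta> (\<Union>i<s. E i) H) C M)" for C
  have "\<exists>C. Q C" unfolding Q_def by (rule spanner_protocol_exists)
  then have "Q (LEAST C. Q C)" by (rule LeastI_ex)
  then show ?thesis unfolding Q_def spanner_complexity_def randomized_complexity_def .
qed

text \<open>All players hold the base edges, so inputs differ only in critical edges. Each of the
  \<open>q\<^sup>2 * (card D)\<^sup>2\<close> routes loses at most \<open>k\<close> of these, the
  routes cover \<open>critical\<close>, and \<open>card critical\<close> is \<open>2 * l - 1\<close>
  times the number of routes.\<close>

theorem spanner_complexity_ge:
  assumes q: "q > 0" and D: "D \<subseteq> {..<q}" and free: "average_free l q D" and l: "60 * k < 2 * l"
    and n: "2 * l * (2 * l + 2) * q ^ 3 \<le> n" and s: "s \<ge> 1"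
  shows "real s * (real q * real (card D))\<^sup>2 \<le> 51840 * ln 8 * (real (spanner_complexity n s k) + real s)"
proof -
  let ?V = "{..<q} \<times> {..<q}"
  obtain enc where G: "layered_graph ?V D (grid_step q) (2 * l) enc n"
    using grid_encoding[OF q D _ n] l by auto
  interpret layered_graph ?V D "grid_step q" "2 * l" enc n by (rule G)
  obtain M where M: "randomized_protocol s (edge_inputs n s)
      (\<lambda>E H. additive_spanner n k (\<Union>i<s. E i) H) (spanner_complexity n s k) M"
    using spanner_randomized_protocol[of s n k] ..
  define g where "g = (\<lambda>(_ :: nat) S. base_edges \<union> critical_edge ` S)"
  define dec where "dec H = {c. critical_edge c \<in> H}" for H
  have union: "(\<Union>i<s. player_inputs g critical x i) =
      base_edges \<union> critical_edge ` {c\<in>critical. x c \<noteq> {}}"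
    if "x \<in> critical \<rightarrow>\<^sub>E Pow {..<s}" for x
  proof -
    have "{c\<in>critical. x c \<noteq> {}} = (\<Union>i<s. {c\<in>critical. i \<in> x c})"
      using that by (force simp: PiE_iff)
    then have "critical_edge ` {c\<in>critical. x c \<noteq> {}} = (\<Union>i<s. critical_edge ` {c\<in>critical. i \<in> x c})"
      by (simp only: image_UN)
    moreover have "(\<Union>i<s. base_edges) = base_edges" using s by (auto simp: lessThan_empty_iff)
    ultimately show ?thesis
      unfolding player_inputs_def g_def by (simp only: UN_Un_distrib)
  qed
  have "real s * real (card critical) \<le> 51840 * ln 8 * (real (spanner_complexity n s k) + real s)"
  proof (rule approximate_union_lower_bound[OF M finite_critical s, where g = g and dec = dec])
    fix x assume x: "x \<in> critical \<rightarrow>\<^sub>E Pow {..<s}"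
    show "player_inputs g critical x \<in> edge_inputs n s"
      using base_edges_subset critical_edge_in
      by (auto simp: edge_inputs_def player_inputs_def g_def)
    fix H assume "additive_spanner n k (\<Union>i<s. player_inputs g critical x i) H"
    then have H: "additive_spanner n k (base_edges \<union> critical_edge ` {c\<in>critical. x c \<noteq> {}}) H"
      by (simp only: union[OF x])
    show "x c \<noteq> {}" if "c \<in> critical" "c \<in> dec H" for c
    proof -
      have "critical_edge c \<in> base_edges \<union> critical_edge ` {c\<in>critical. x c \<noteq> {}}"
        using H that(2) by (auto simp: dec_def additive_spanner_def)
      then show ?thesis
        using critical_edge_not_base[OF that(1)] critical_edge_eqD[OF that(1)] by auto
    qed
    define lost where "lost v d e = {t. t < 2 * l - 1 \<and>
      (let c = (t, route_pos q v d e t, route_lab d e t, route_lab d e (Suc t))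
       in c \<in> {c\<in>critical. x c \<noteq> {}} \<and> critical_edge c \<notin> H)}" for v d e
    have lost: "card (lost v d e) \<le> k" if "d \<in> D" "e \<in> D" for v d e
    proof -
      interpret rigid_route ?V D "grid_step q" "2 * l" enc n
        "route_pos q v d e" "route_lab d e" "route_co l q D v d e"
        by (rule grid_rigid_route[OF G q free that])
      show ?thesis
        using spanner_contains_most[OF _ H] by (simp add: lost_def crit_def Let_def)
    qed
    have fin_lost: "finite (lost v d e)" for v d e by (simp add: lost_def)
    let ?L = "SIGMA (v, d, e) : ?V \<times> D \<times> D. lost v d e"
    let ?f = "\<lambda>((v, d, e), t). (t, route_pos q v d e t, route_lab d e t, route_lab d e (Suc t))"
    have "{c\<in>critical. x c \<noteq> {} \<and> c \<notin> dec H} \<subseteq> ?f ` ?L"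
    proof
      fix c assume c: "c \<in> {c\<in>critical. x c \<noteq> {} \<and> c \<notin> dec H}"
      obtain t w1 w2 b b' where cc: "c = (t, (w1, w2), b, b')" by (metis surj_pair)
      then have w: "w1 < q" "w2 < q" "t < 2 * l - 1" "b \<in> D" "b' \<in> D"
        using c by (auto simp: critical_def)
      \<comment> \<open>Step \<open>t\<close> uses \<open>b\<close> and step \<open>t + 1\<close>
        uses \<open>b'\<close>; parity tells which is the label of the even steps. The start of the
        route is then found by walking back.\<close>
      define d where "d = (if even t then b else b')"
      define e where "e = (if even t then b' else b)"
      obtain v1 where v1: "v1 < q" "(v1 + (t + 1) div 2 * d) mod q = w1"
        using ex_mod_add_eq[OF w(1)] by blast
      obtain v2 where v2: "v2 < q" "(v2 + t div 2 * e) mod q = w2"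
        using ex_mod_add_eq[OF w(2)] by blast
      have eq: "c = ?f (((v1, v2), d, e), t)"
        using v1 v2 by (simp add: cc route_pos_def route_lab_def d_def e_def)
      moreover have "(((v1, v2), d, e), t) \<in> ?L"
        using c w v1 v2 eq by (auto simp: d_def e_def lost_def dec_def Let_def)
      ultimately show "c \<in> ?f ` ?L" by blast
    qed
    then have "card {c\<in>critical. x c \<noteq> {} \<and> c \<notin> dec H} \<le> card ?L"
      using finV finD fin_lost
      by (intro surj_card_le) auto
    also have "\<dots> = (\<Sum>(v, d, e)\<in>?V \<times> D \<times> D. card (lost v d e))"
      using finD fin_lost by (subst card_SigmaI) (auto simp: case_prod_beta)
    also have "\<dots> \<le> (\<Sum>(v, d, e)\<in>?V \<times> D \<times> D. k)"
      using lost by (intro sum_mono) auto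
    also have "\<dots> = k * (card ?V * (card D)\<^sup>2)"
      by (simp add: card_cartesian_product power2_eq_square)
    finally have "60 * card {c\<in>critical. x c \<noteq> {} \<and> c \<notin> dec H} \<le> 60 * k * (card ?V * (card D)\<^sup>2)"
      by simp
    also have "\<dots> \<le> (2 * l - 1) * (card ?V * (card D)\<^sup>2)"
      using l by (intro mult_right_mono) auto
    finally show "60 * card {c\<in>critical. x c \<noteq> {} \<and> c \<notin> dec H} \<le> card critical"
      by (simp add: card_critical)
  qed
  moreover have "(real q * real (card D))\<^sup>2 \<le> real (card critical)"
  proof -
    have "(q * card D)\<^sup>2 = 1 * (card ?V * (card D)\<^sup>2)"
      by (simp add: card_cartesian_product power2_eq_square)
    also have "\<dots> \<le> card critical"
      unfolding card_critical using l by (intro mult_right_mono) auto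
    finally have "real ((q * card D)\<^sup>2) \<le> real (card critical)" by (simp only: of_nat_le_iff)
    then show ?thesis by simp
  qed
  ultimately show ?thesis using mult_left_mono[of _ _ "real s"] by fastforce
qed

section \<open>Average-free sets and the final bound\<close>

text \<open>First components are numbers with \<open>p\<close> digits below \<open>b\<close> in base \<open>l * b\<close>, so that sums of \<open>l\<close> of
  them have no carries; the second component is the sum of the squares of the digits. Using it as a
  further leading digit forces equality by strict convexity.\<close>

primrec digit_pairs :: "nat \<Rightarrow> nat \<Rightarrow> nat \<Rightarrow> (nat \<times> nat) set" where
  "digit_pairs l b 0 = {(0, 0)}"
| "digit_pairs l b (Suc p) = (\<lambda>((x, w), a). (x * (l * b) + a, w + a\<^sup>2)) ` (digit_pairs l b p \<times> {..<b})"

lemma mult_add_eqD: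
  fixes B :: nat
  assumes "x * B + a = y * B + c" "a < B" "c < B"
  shows "x = y" "a = c"
proof -
  have "(a + B * x) div B = (c + B * y) div B" using assms(1) by (simp add: mult.commute add.commute)
  then show "x = y" using assms(2,3) by simp
  then show "a = c" using assms(1) by simp
qed

text \<open>The factor \<open>l\<close> leaves room for sums of \<open>l\<close> first components
  below \<open>(l * b) ^ p\<close>, the place value of the leading digit.\<close>

lemma digit_pairs_bounds:
  assumes "e \<in> digit_pairs l b p" "l > 0"
  shows "l * fst e < (l * b) ^ p" "snd e \<le> p * b\<^sup>2"
  using assms(1)
proof (induction p arbitrary: e)
  case (Suc p)
  { case 1
    then obtain x w a where e: "e = (x * (l * b) + a, w + a\<^sup>2)" "(x, w) \<in> digit_pairs l b p" "a < b" by auto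
    have "l * x + 1 \<le> (l * b) ^ p" using Suc.IH(1)[OF e(2)] by simp
    then have "(l * x + 1) * (l * b) \<le> (l * b) ^ p * (l * b)" by (rule mult_le_mono1)
    moreover have "l * a < l * b" using e(3) assms(2) by simp
    ultimately have "l * x * (l * b) + l * a < (l * b) ^ p * (l * b)"
      unfolding distrib_right by linarith
    moreover have "l * fst e = l * x * (l * b) + l * a" by (simp add: e(1) algebra_simps)
    ultimately show ?case by (simp only: power_Suc2)
  next
    case 2
    then obtain x w a where e: "e = (x * (l * b) + a, w + a\<^sup>2)" "(x, w) \<in> digit_pairs l b p" "a < b" by auto
    have "a\<^sup>2 \<le> b\<^sup>2" using e(3) by (intro power_mono) auto
    with Suc.IH(2)[OF e(2)] have "w + a\<^sup>2 \<le> p * b\<^sup>2 + b\<^sup>2"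
      unfolding snd_conv by (rule add_mono)
    then show ?case by (simp add: e(1) add.commute)
  }
qed (use assms(2) in auto)

lemma card_digit_pairs:
  assumes l: "l > 0"
  shows "card (digit_pairs l b p) = b ^ p"
proof (induction p)
  case (Suc p)
  have "inj_on (\<lambda>((x, w), a). (x * (l * b) + a, w + a\<^sup>2)) (digit_pairs l b p \<times> {..<b})"
  proof (rule inj_onI, clarsimp)
    fix x w a x' w' a'
    assume *: "(x, w) \<in> digit_pairs l b p" "a < b" "(x', w') \<in> digit_pairs l b p" "a' < b"
      "x * (l * b) + a = x' * (l * b) + a'" "w + a\<^sup>2 = w' + a'\<^sup>2"
    have "b \<le> l * b" using l by simp
    then have "a < l * b" "a' < l * b" using * by linarith+
    then have "x = x'" "a = a'" using mult_add_eqD[of x "l * b" a x' a'] * by simp_all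
    then show "x = x' \<and> w = w' \<and> a = a'" using *(6) by simp
  qed
  then show ?case using Suc by (simp add: card_image card_cartesian_product)
qed simp

text \<open>The variance of the \<open>a i\<close> about their mean \<open>m\<close> is nonnegative
  and vanishes only for constants.\<close>

lemma sum_squares_mean:
  fixes a :: "nat \<Rightarrow> nat"
  assumes "(\<Sum>i<l. a i) = l * m"
  shows "l * m\<^sup>2 \<le> (\<Sum>i<l. (a i)\<^sup>2)"
    and "(\<Sum>i<l. (a i)\<^sup>2) = l * m\<^sup>2 \<Longrightarrow> i < l \<Longrightarrow> a i = m"
proof -
  have "(\<Sum>i<l. (int (a i) - int m)\<^sup>2) =
      (\<Sum>i<l. (int (a i))\<^sup>2) - 2 * int m * int (\<Sum>i<l. a i) + int l * (int m)\<^sup>2"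
    by (simp add: power2_diff sum.distrib sum_subtractf sum_distrib_left algebra_simps)
  also have "\<dots> = (\<Sum>i<l. (int (a i))\<^sup>2) - int l * (int m)\<^sup>2"
    unfolding assms by (simp add: power2_eq_square)
  finally have eq: "(\<Sum>i<l. (int (a i) - int m)\<^sup>2) = int (\<Sum>i<l. (a i)\<^sup>2) - int (l * m\<^sup>2)" by simp
  have "(\<Sum>i<l. (int (a i) - int m)\<^sup>2) \<ge> 0" by (intro sum_nonneg) auto
  then show "l * m\<^sup>2 \<le> (\<Sum>i<l. (a i)\<^sup>2)" unfolding eq by linarith
  show "a i = m" if "(\<Sum>i<l. (a i)\<^sup>2) = l * m\<^sup>2" "i < l"
  proof -
    have "(\<Sum>i<l. (int (a i) - int m)\<^sup>2) = 0" unfolding eq that(1) by simp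
    then have "\<forall>i\<in>{..<l}. (int (a i) - int m)\<^sup>2 = 0" by (subst (asm) sum_nonneg_eq_0_iff) auto
    then show ?thesis using that(2) by simp
  qed
qed

lemma sum_less_of_mult_less:
  fixes f :: "nat \<Rightarrow> nat"
  assumes "\<And>i. i < l \<Longrightarrow> l * f i < B" "l > 0"
  shows "(\<Sum>i<l. f i) < B"
proof -
  have "(\<Sum>i<l. l * f i) < (\<Sum>i<l. B)"
    using assms by (intro sum_strict_mono) auto
  then have "l * (\<Sum>i<l. f i) < l * B" by (simp add: sum_distrib_left)
  then show ?thesis by simp
qed

text \<open>Digit sums stay below \<open>l * b\<close>, so equality of the first components splits
  into one mean per digit, and \<open>sum_squares_mean\<close> applies to each digit.\<close>

lemma digit_pairs_convex:
  assumes l: "l > 0"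
  shows "e \<in> digit_pairs l b p \<Longrightarrow> (\<And>i. i < l \<Longrightarrow> f i \<in> digit_pairs l b p) \<Longrightarrow>
    (\<Sum>i<l. fst (f i)) = l * fst e \<Longrightarrow>
    l * snd e \<le> (\<Sum>i<l. snd (f i)) \<and>
    ((\<Sum>i<l. snd (f i)) = l * snd e \<longrightarrow> (\<forall>i<l. f i = e))"
proof (induction p arbitrary: e f)
  case 0
  then show ?case by auto
next
  case (Suc p)
  obtain e' a where e: "e = (fst e' * (l * b) + a, snd e' + a\<^sup>2)" "e' \<in> digit_pairs l b p" "a < b"
    using Suc.prems(1) by auto
  have "\<exists>g c. f i = (fst g * (l * b) + c, snd g + c\<^sup>2) \<and> g \<in> digit_pairs l b p \<and> c < b" if "i < l" for i
    using Suc.prems(2)[OF that] by fastforce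
  then obtain g c where f: "\<And>i. i < l \<Longrightarrow> f i = (fst (g i) * (l * b) + c i, snd (g i) + (c i)\<^sup>2)"
    "\<And>i. i < l \<Longrightarrow> g i \<in> digit_pairs l b p" "\<And>i. i < l \<Longrightarrow> c i < b"
    by metis
  have sum_fst: "(\<Sum>i<l. fst (f i)) = (\<Sum>i<l. fst (g i)) * (l * b) + (\<Sum>i<l. c i)"
    by (simp add: f(1) sum.distrib sum_distrib_right)
  have sum_snd: "(\<Sum>i<l. snd (f i)) = (\<Sum>i<l. snd (g i)) + (\<Sum>i<l. (c i)\<^sup>2)"
    by (simp add: f(1) sum.distrib)
  have "(\<Sum>i<l. fst (g i)) * (l * b) + (\<Sum>i<l. c i) = (l * fst e') * (l * b) + l * a"
    using Suc.prems(3) unfolding sum_fst by (simp add: e(1) algebra_simps)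
  moreover have "(\<Sum>i<l. c i) < l * b" using f(3) l by (intro sum_less_of_mult_less) auto
  moreover have "l * a < l * b" using e(3) l by simp
  ultimately have g: "(\<Sum>i<l. fst (g i)) = l * fst e'" and c: "(\<Sum>i<l. c i) = l * a"
    using mult_add_eqD by blast+
  note IH = Suc.IH[OF e(2) f(2) g] and sq = sum_squares_mean[OF c]
  have "l * snd e = l * snd e' + l * a\<^sup>2" by (simp add: e(1) algebra_simps)
  moreover have "f i = e"
    if "i < l" "(\<Sum>i<l. snd (g i)) = l * snd e'" "(\<Sum>i<l. (c i)\<^sup>2) = l * a\<^sup>2" for i
    using IH sq(2)[OF that(3,1)] that by (simp add: f(1) e(1))
  moreover have "l * snd e' \<le> (\<Sum>i<l. snd (g i))" using IH by blast
  ultimately have *: "l * snd e = l * snd e' + l * a\<^sup>2" "l * snd e' \<le> (\<Sum>i<l. snd (g i))"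
    "\<And>i. i < l \<Longrightarrow> (\<Sum>i<l. snd (g i)) = l * snd e' \<Longrightarrow> (\<Sum>i<l. (c i)\<^sup>2) = l * a\<^sup>2 \<Longrightarrow> f i = e"
    by blast+
  show ?case
    unfolding sum_snd
  proof (intro conjI impI allI)
    show "l * snd e \<le> (\<Sum>i<l. snd (g i)) + (\<Sum>i<l. (c i)\<^sup>2)"
      using *(1,2) sq(1) by linarith
    fix i assume i: "i < l" and "(\<Sum>i<l. snd (g i)) + (\<Sum>i<l. (c i)\<^sup>2) = l * snd e"
    then have "(\<Sum>i<l. snd (g i)) = l * snd e'" "(\<Sum>i<l. (c i)\<^sup>2) = l * a\<^sup>2"
      using *(1,2) sq(1) by linarith+
    then show "f i = e" by (rule *(3)[OF i])
  qed
qed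

text \<open>Behrend fixes one sphere of digit vectors by pigeonhole. Here all spheres are kept and
  the squared norm becomes the leading digit, so all \<open>b ^ p\<close> vectors survive at the
  price of a factor of about \<open>l * p * b\<^sup>2\<close> in \<open>q\<close>. The condition on
  \<open>q\<close> keeps sums of \<open>l\<close> members below \<open>q\<close>, so congruence is
  equality.\<close>

theorem average_free_set_exists:
  assumes l: "l > 0" and q: "(l * b) ^ p * (1 + l * (p * b\<^sup>2)) \<le> q"
  shows "\<exists>D. D \<subseteq> {..<q} \<and> card D = b ^ p \<and> average_free l q D"
proof -
  define B where "B = (l * b) ^ p"
  define h where "h e = snd e * B + fst e" for e :: "nat \<times> nat"
  define S where "S = digit_pairs l b p"
  have S: "l * fst e < B" "snd e \<le> p * b\<^sup>2" if "e \<in> S" for e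
    using digit_pairs_bounds[OF that[unfolded S_def] l] by (simp_all add: B_def)
  have lh: "l * h e < q" if "e \<in> S" for e
  proof -
    have "l * h e = l * snd e * B + l * fst e" by (simp add: h_def algebra_simps)
    also have "\<dots> < l * (p * b\<^sup>2) * B + B"
      using S[OF that] by (intro add_le_less_mono mult_le_mono) auto
    also have "\<dots> \<le> q" using q by (simp add: B_def algebra_simps)
    finally show ?thesis .
  qed
  have "e = e'" if "e \<in> S" "e' \<in> S" "h e = h e'" for e e'
  proof -
    have "fst e \<le> l * fst e" "fst e' \<le> l * fst e'" using l by simp_all
    then have "fst e < B" "fst e' < B" using S(1)[OF that(1)] S(1)[OF that(2)] by linarith+
    then show ?thesis
      using mult_add_eqD[of "snd e" B "fst e" "snd e'" "fst e'"] that(3) by (auto simp: h_def prod_eq_iff)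
  qed
  then have "inj_on h S" by (rule inj_onI)
  then have "card (h ` S) = b ^ p"
    using card_digit_pairs[OF l] by (simp add: card_image S_def)
  moreover have "h ` S \<subseteq> {..<q}"
  proof -
    have "h e \<le> l * h e" for e using l by simp
    then show ?thesis using lh le_less_trans by blast
  qed
  moreover have "average_free l q (h ` S)"
    unfolding average_free_def
  proof (intro ballI allI impI, elim conjE)
    fix d f i assume d: "d \<in> h ` S" and f: "\<forall>i<l. f i \<in> h ` S" and eq: "(\<Sum>i<l. f i) mod q = l * d mod q" and i: "i < l"
    obtain e where e: "e \<in> S" "d = h e" using d by auto
    have "\<forall>i. \<exists>e. i < l \<longrightarrow> e \<in> S \<and> f i = h e" using f by blast
    then obtain F where "\<forall>i. i < l \<longrightarrow> F i \<in> S \<and> f i = h (F i)" by (rule choice[THEN exE])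
    then have F: "\<And>i. i < l \<Longrightarrow> F i \<in> S" "\<And>i. i < l \<Longrightarrow> f i = h (F i)" by simp_all
    have "(\<Sum>i<l. f i) < q" using F lh l by (intro sum_less_of_mult_less) auto
    moreover have "l * d < q" using e lh by simp
    ultimately have "(\<Sum>i<l. f i) = l * d" using eq by simp
    moreover have "(\<Sum>i<l. f i) = (\<Sum>i<l. snd (F i)) * B + (\<Sum>i<l. fst (F i))"
      by (simp add: F(2) h_def sum.distrib sum_distrib_right)
    moreover have "l * d = (l * snd e) * B + l * fst e" by (simp add: e(2) h_def algebra_simps)
    moreover have "(\<Sum>i<l. fst (F i)) < B" using F S l by (intro sum_less_of_mult_less) auto
    moreover have "l * fst e < B" using S e by simp
    ultimately have "(\<Sum>i<l. snd (F i)) = l * snd e" "(\<Sum>i<l. fst (F i)) = l * fst e"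
      using mult_add_eqD[of "\<Sum>i<l. snd (F i)" B "\<Sum>i<l. fst (F i)" "l * snd e" "l * fst e"] by simp_all
    then have "F i = e"
      using digit_pairs_convex[OF l, of e b p F] e F i by (auto simp: S_def)
    then show "f i = d" using F(2)[OF i] e by simp
  qed
  ultimately show ?thesis by blast
qed

text \<open>Up to constants \<open>card D\<close> is \<open>b ^ p\<close> and \<open>q\<close> is
  \<open>b ^ (p + 2)\<close>, so \<open>b ^ (3 * (p + 2))\<close> vertices give a bound
  \<open>s * b ^ (4 * p + 4)\<close>; the ratio of the exponents tends to 4/3. The quantifier over
  \<open>s\<close> stands inside the filter because one threshold must serve every
  \<open>s\<close>.\<close>

lemma eventually_spanner_complexity_ge:
  assumes k: "k \<ge> 1" and \<epsilon>: "0 < \<epsilon>" "\<epsilon> \<le> 1"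
  shows "\<forall>\<^sub>F n in sequentially. \<forall>s\<ge>1. real s * real n powr (4 / 3 - \<epsilon>) \<le> real (spanner_complexity n s k)"
proof -
  \<comment> \<open>\<open>b\<close> is about \<open>n powr (1 / (3 * (p + 3)))\<close> rather than \<open>n powr (1 / (3 * (p + 2)))\<close>: the slack absorbs all constants.\<close>
  define l where "l = 31 * k"
  have l: "l > 0" "60 * k < 2 * l" using k by (simp_all add: l_def)
  \<comment> \<open>The loss \<open>4 / 3 - \<gamma>\<close> will be
    \<open>8 / (3 * (p + 3))\<close>.\<close>
  obtain p :: nat where p: "8 / (3 * \<epsilon>) < real p" using reals_Archimedean2 by blast
  have "0 < 8 / (3 * \<epsilon>)" using \<epsilon> by simp
  then have p0: "p > 0" using p by (simp only: of_nat_0_less_iff[symmetric, where 'a = real] less_trans)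
  define \<theta> where "\<theta> = 1 / (3 * (real p + 3))"
  define \<gamma> where "\<gamma> = \<theta> * (4 * real p + 4)"
  define K where "K = 51840 * ln 8 * (2 :: real) ^ (4 * p + 4)"
  have K: "K > 0" by (simp add: K_def)
  have \<theta>: "\<theta> > 0" by (simp add: \<theta>_def)
  have \<gamma>: "\<gamma> > 4 / 3 - \<epsilon>"
  proof -
    have "4 / 3 - \<gamma> = 8 / (3 * (real p + 3))" by (simp add: \<gamma>_def \<theta>_def field_simps)
    also have "\<dots> < \<epsilon>" using p \<epsilon> by (simp add: field_simps)
    finally show ?thesis by simp
  qed
  define b where "b n = nat \<lfloor>real n powr \<theta>\<rfloor>" for n
  define q where "q n = (l * b n) ^ p * (1 + l * (p * (b n)\<^sup>2))" for n
  define c where "c = 2 * l * (2 * l + 2) * (l ^ p * (1 + l * p)) ^ 3"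
  have lim: "filterlim (\<lambda>n. real n powr a) at_top sequentially" if "a > 0" for a
    using that by real_asymp
  have lim_b: "\<forall>\<^sub>F n in sequentially. real n powr \<theta> \<ge> 1"
    using lim[OF \<theta>] by (simp add: filterlim_at_top)
  have exp1: "3 * (real p + 2) * \<theta> < 1" by (simp add: \<theta>_def field_simps)
  have lim_c: "\<forall>\<^sub>F n in sequentially. real n powr (1 - 3 * (real p + 2) * \<theta>) \<ge> real c"
    using lim[of "1 - 3 * (real p + 2) * \<theta>"] exp1 by (simp add: filterlim_at_top)
  have lim_K: "\<forall>\<^sub>F n in sequentially. real n powr (\<gamma> - (4 / 3 - \<epsilon>)) \<ge> 2 * K"
    using lim[of "\<gamma> - (4 / 3 - \<epsilon>)"] \<gamma> by (simp add: filterlim_at_top)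
  show ?thesis
    using lim_b lim_c lim_K eventually_ge_at_top[of 1]
  proof eventually_elim
    case (elim n)
    have n: "real n \<ge> 1" using elim(4) by simp
    have b_le: "real (b n) \<le> real n powr \<theta>" by (simp add: b_def)
    have b_ge: "real n powr \<theta> \<le> 2 * real (b n)" and b1: "b n \<ge> 1"
    proof -
      show "b n \<ge> 1" using elim(1) by (simp add: b_def le_nat_floor)
      moreover have "real n powr \<theta> \<le> real (b n) + 1"
        using real_of_int_floor_add_one_ge[of "real n powr \<theta>"] elim(1) by (simp add: b_def)
      ultimately show "real n powr \<theta> \<le> 2 * real (b n)" by linarith
    qed
    have b_pow: "real (b n) ^ j \<le> real n powr (real j * \<theta>)" for j
    proof -
      have "real (b n) ^ j \<le> (real n powr \<theta>) ^ j" using b_le by (intro power_mono) auto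
      also have "\<dots> = real n powr (real j * \<theta>)"
        using n by (simp add: powr_realpow[symmetric] powr_powr mult.commute)
      finally show ?thesis .
    qed
    have q_le: "q n \<le> l ^ p * (1 + l * p) * b n ^ (p + 2)"
    proof -
      have "1 + l * (p * (b n)\<^sup>2) \<le> (1 + l * p) * (b n)\<^sup>2"
        using b1 by (simp add: algebra_simps)
      then have "q n \<le> (l * b n) ^ p * ((1 + l * p) * (b n)\<^sup>2)"
        unfolding q_def by (rule mult_le_mono2)
      also have "\<dots> = l ^ p * (1 + l * p) * b n ^ (p + 2)"
        by (simp add: power_mult_distrib power_add power2_eq_square algebra_simps)
      finally show ?thesis .
    qed
    have q_ge: "q n \<ge> b n ^ (p + 2)"
    proof -
      have "b n ^ p \<le> (l * b n) ^ p" using l by (intro power_mono) auto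
      moreover have "(b n)\<^sup>2 \<le> 1 + l * (p * (b n)\<^sup>2)"
      proof -
        have "1 * (b n)\<^sup>2 \<le> l * p * (b n)\<^sup>2" using l p0 by (intro mult_le_mono1) simp
        then show ?thesis unfolding mult.assoc mult_1 by linarith
      qed
      ultimately show ?thesis unfolding q_def power_add by (intro mult_le_mono)
    qed
    have "2 * l * (2 * l + 2) * q n ^ 3 \<le> 2 * l * (2 * l + 2) * (l ^ p * (1 + l * p) * b n ^ (p + 2)) ^ 3"
      using q_le by (intro mult_le_mono2 power_mono) auto
    also have "\<dots> = c * b n ^ (3 * (p + 2))"
      unfolding c_def power_mult_distrib power_mult[symmetric] by (simp add: mult.commute mult.left_commute)
    finally have "real (2 * l * (2 * l + 2) * q n ^ 3) \<le> real (c * b n ^ (3 * (p + 2)))"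
      by (simp only: of_nat_le_iff)
    also have "\<dots> = real c * real (b n) ^ (3 * (p + 2))" by simp
    also have "\<dots> \<le> real n powr (1 - 3 * (real p + 2) * \<theta>) * real n powr (real (3 * (p + 2)) * \<theta>)"
      by (intro mult_mono elim(2) b_pow) auto
    also have "\<dots> = real n" using n by (simp add: powr_add[symmetric] algebra_simps)
    finally have n_ge: "2 * l * (2 * l + 2) * q n ^ 3 \<le> n" by (simp only: of_nat_le_iff)
    obtain D where D: "D \<subseteq> {..<q n}" "card D = b n ^ p" "average_free l (q n) D"
      using average_free_set_exists[OF l(1) eq_refl[OF q_def[symmetric]]] by blast
    have "0 < b n ^ (p + 2)" using b1 by simp
    then have q0: "q n > 0" using q_ge by (rule less_le_trans)
    have "real n powr \<gamma> = (real n powr \<theta>) ^ (4 * p + 4)"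
      using n by (simp add: \<gamma>_def powr_realpow[symmetric] powr_powr)
    also have "\<dots> \<le> (2 * real (b n)) ^ (4 * p + 4)" using b_ge by (intro power_mono) auto
    also have "\<dots> = 2 ^ (4 * p + 4) * (real (b n) ^ (p + 2) * real (b n) ^ p)\<^sup>2"
    proof -
      have "(p + 2 + p) * 2 = 4 * p + 4" by simp
      then show ?thesis
        by (simp only: power_mult_distrib power_add[symmetric] power_mult[symmetric])
    qed
    also have "\<dots> \<le> 2 ^ (4 * p + 4) * (real (q n) * real (card D))\<^sup>2"
    proof -
      have "real (b n) ^ (p + 2) \<le> real (q n)" using q_ge by (simp only: of_nat_le_iff of_nat_power[symmetric])
      then show ?thesis
        unfolding D(2) by (intro mult_left_mono power_mono mult_mono) auto
    qed
    finally have n\<gamma>: "real n powr \<gamma> \<le> 2 ^ (4 * p + 4) * (real (q n) * real (card D))\<^sup>2" .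
    have "real n powr \<gamma> = real n powr (\<gamma> - (4 / 3 - \<epsilon>)) * real n powr (4 / 3 - \<epsilon>)"
      by (simp add: powr_add[symmetric])
    then have big: "2 * K * real n powr (4 / 3 - \<epsilon>) \<le> real n powr \<gamma>"
      using elim(3) by (simp add: mult_right_mono)
    have one: "1 \<le> real n powr (4 / 3 - \<epsilon>)" using n \<epsilon> by (intro ge_one_powr_ge_zero) auto
    show ?case
    proof (intro allI impI)
      fix s :: nat assume s: "s \<ge> 1"
      let ?C = "real (spanner_complexity n s k)"
      have "real s * real n powr \<gamma> \<le> 2 ^ (4 * p + 4) * (real s * (real (q n) * real (card D))\<^sup>2)"
        using mult_left_mono[OF n\<gamma>, of "real s"] by (simp add: mult.left_commute)
      also have "\<dots> \<le> 2 ^ (4 * p + 4) * (51840 * ln 8 * (?C + real s))"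
        by (intro mult_left_mono spanner_complexity_ge[OF q0 D(1,3) l(2) n_ge s]) auto
      also have "\<dots> = K * (?C + real s)" by (simp add: K_def)
      finally have up: "real s * real n powr \<gamma> \<le> K * (?C + real s)" .
      \<comment> \<open>One half of the factor 2 pays for the additive \<open>real s\<close>, since
        the power of \<open>n\<close> is at least 1.\<close>
      have "K * (2 * (real s * real n powr (4 / 3 - \<epsilon>))) \<le> real s * real n powr \<gamma>"
        using mult_left_mono[OF big, of "real s"] by (simp add: mult.left_commute mult.assoc)
      with up have "K * (2 * (real s * real n powr (4 / 3 - \<epsilon>))) \<le> K * (?C + real s)" by simp
      then have "2 * (real s * real n powr (4 / 3 - \<epsilon>)) \<le> ?C + real s" using K by simp
      moreover have "real s \<le> real s * real n powr (4 / 3 - \<epsilon>)"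
        using mult_left_mono[OF one, of "real s"] by simp
      ultimately show "real s * real n powr (4 / 3 - \<epsilon>) \<le> ?C" by simp
    qed
  qed
qed

theorem theorem3p5:
  fixes k :: nat
  assumes "k \<ge> 1"
  shows "\<exists>\<delta> :: nat \<Rightarrow> real. \<delta> \<in> o(\<lambda>_. 1) \<and>
    (\<forall>s :: nat \<Rightarrow> nat. (\<forall>n. s n \<ge> 1) \<and> (\<lambda>n. real (s n)) \<in> o(\<lambda>n. real n) \<longrightarrow>
      (\<lambda>n. real (spanner_complexity n (s n) k)) \<in> \<Omega>(\<lambda>n. real (s n) * real n powr (4 / 3 - \<delta> n)))"
proof -
  \<comment> \<open>The worst ratio over all \<open>s\<close>. Defining \<open>\<delta>\<close> from
    it yields one function for every sequence \<open>s\<close>, with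
    \<open>n powr (4 / 3 - \<delta> n) \<le> A n\<close> as soon as \<open>n \<ge> 2\<close> and
    \<open>A n > 0\<close>.\<close>
  define A where "A n = (INF s\<in>{1..}. real (spanner_complexity n s k) / real s)" for n
  define \<delta> where "\<delta> n = max 0 (4 / 3 - log n (A n))" for n :: nat
  have A_le: "A n \<le> real (spanner_complexity n s k) / real s" if "s \<ge> 1" for n s
    unfolding A_def using that by (intro cINF_lower) (auto intro!: bdd_belowI2[of _ 0])
  have A_ge: "\<forall>\<^sub>F n in sequentially. real n powr (4 / 3 - \<epsilon>) \<le> A n" if "0 < \<epsilon>" "\<epsilon> \<le> 1" for \<epsilon>
    using eventually_spanner_complexity_ge[OF assms that]
  proof eventually_elim
    case (elim n)
    show ?case
      unfolding A_def
    proof (rule cINF_greatest)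
      show "real n powr (4 / 3 - \<epsilon>) \<le> real (spanner_complexity n s k) / real s" if "s \<in> {1..}" for s
        using elim that by (simp add: field_simps)
    qed simp
  qed
  have "\<forall>\<^sub>F n in sequentially. norm (\<delta> n) \<le> c * norm (1 :: real)" if c: "c > 0" for c
  proof -
    define \<epsilon> where "\<epsilon> = min c 1"
    have \<epsilon>: "0 < \<epsilon>" "\<epsilon> \<le> 1" "\<epsilon> \<le> c" using c by (auto simp: \<epsilon>_def)
    show ?thesis
      using A_ge[OF \<epsilon>(1,2)] eventually_ge_at_top[of 2]
    proof eventually_elim
      case (elim n)
      have "real n powr (4 / 3 - \<epsilon>) > 0" using elim(2) by simp
      moreover from this have "A n > 0" using elim(1) by (rule less_le_trans)
      ultimately have "log n (real n powr (4 / 3 - \<epsilon>)) \<le> log n (A n)"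
        using elim by (subst log_le_cancel_iff) auto
      then have "4 / 3 - \<epsilon> \<le> log n (A n)" using elim(2) by simp
      then show ?case using \<epsilon> by (simp add: \<delta>_def)
    qed
  qed
  then have "\<delta> \<in> o(\<lambda>_. 1)" by (intro landau_o.smallI)
  moreover have "(\<lambda>n. real (spanner_complexity n (s n) k)) \<in> \<Omega>(\<lambda>n. real (s n) * real n powr (4 / 3 - \<delta> n))"
    if s: "\<forall>n. s n \<ge> 1" for s
  proof (rule landau_omega.bigI[of 1])
    show "\<forall>\<^sub>F n in sequentially. norm (real (spanner_complexity n (s n) k))
        \<ge> 1 * norm (real (s n) * real n powr (4 / 3 - \<delta> n))"
      \<comment> \<open>The case \<open>\<epsilon> = 1\<close> serves only to make
        \<open>A n\<close> positive.\<close>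
      using A_ge[OF zero_less_one order_refl] eventually_ge_at_top[of 2]
    proof eventually_elim
      case (elim n)
      have "real n powr (4 / 3 - 1) > 0" using elim(2) by simp
      then have A0: "A n > 0" using elim(1) by (rule less_le_trans)
      have "4 / 3 - \<delta> n \<le> log n (A n)" by (simp add: \<delta>_def)
      then have "real n powr (4 / 3 - \<delta> n) \<le> real n powr log n (A n)"
        using elim(2) by (intro powr_mono) auto
      also have "\<dots> = A n" using elim(2) A0 by (intro powr_log_cancel) auto
      also have "\<dots> \<le> real (spanner_complexity n (s n) k) / real (s n)"
        using A_le s by simp
      finally show ?case
        using s by (simp add: field_simps abs_mult less_eq_Suc_le)
    qed
  qed simp
  ultimately show ?thesis by blast
qed

end
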